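(* Let $\mu>0$, $n=\lfloor\mu\rfloor+1$, $s\in\mathbb{R}$, and let $\Psi\in C^1([a,b])$ be an increasing positive function on $[a,b]\subset\mathbb{R}$ with $\Psi'(x)\ne0$ for all $x\in[a,b]$. If $f$ is an integrable function on $[a,b]$ such that ${}^{H}_{a}I^{n-\mu,s}_{\Psi(x)}f\in AC^{n}_{\delta^{\Psi},s}[a,b]$, then we have $${}^{H}_{a}I^{\mu,s}_{\Psi(x)}\,{}^{HR}_{a}D^{\mu,s}_{\Psi(x)}f(x)=f(x)-\left(\frac{\Psi(a)}{\Psi(x)}\right)^s\sum_{k=1}^{n}\frac{1}{\Gamma(\mu-k+1)}\left(\log\frac{\Psi(x)}{\Psi(a)}\right)^{\mu-k}\lim_{x\to a^+}{}^{HR}_{a}D^{\mu-k,s}_{\Psi(x)}f(x).$$ In particular, for $0<\mu<1$ we have $${}^{H}_{a}I^{\mu,s}_{\Psi(x)}\,{}^{HR}_{a}D^{\mu,s}_{\Psi(x)}f(x)=f(x)-\frac{1}{\Gamma(\mu)}\left(\frac{\Psi(a)}{\Psi(x)}\right)^s\left(\log\frac{\Psi(x)}{\Psi(a)}\right)^{\mu-1}\lim_{x\to a^+}{}^{H}_{a}I^{1-\mu,s}_{\Psi(x)}f(x).$$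
   Context: Here $a<b$ are real numbers. Function space: $$AC^{n}_{\delta^{\Psi},s}[a,b]=\left\{h:[a,b]\to\mathbb{C}:\ \left(\frac{\Psi(x)}{\Psi'(x)}\frac{d}{dx}\right)^{n-1}\big[\Psi(x)^sh(x)\big]\in AC[a,b]\right\},$$ where $AC[a,b]$ is the set of absolutely continuous functions on $[a,b]$. Hadamard-type operators with respect to $\Psi$: for $\mu>0$, $${}^{H}_{a}I^{\mu,s}_{\Psi(x)}f(x)=\frac{1}{\Gamma(\mu)}\int_{a}^{x}\left(\frac{\Psi(t)}{\Psi(x)}\right)^{s}\left(\log\frac{\Psi(x)}{\Psi(t)}\right)^{\mu-1}f(t)\frac{\Psi'(t)}{\Psi(t)}\,dt;$$ for a nonnegative integer $n$, $${}^{H}_{a}D^{n,s}_{\Psi(x)}f(x)=\Psi(x)^{-s}\left(\frac{\Psi(x)}{\Psi'(x)}\frac{d}{dx}\right)^{n}\big[\Psi(x)^{s}f(x)\big];$$ and for $\mu\ge0$ with $n=\lfloor\mu\rfloor+1$, the Riemann–Liouville-type derivative is ${}^{HR}_{a}D^{\mu,s}_{\Psi(x)}f={}^{H}_{a}D^{n,s}_{\Psi(x)}\,{}^{H}_{a}I^{n-\mu,s}_{\Psi(x)}f$. For negative index the convention is ${}^{HR}_{a}D^{-\mu,s}_{\Psi(x)}={}^{H}_{a}I^{\mu,s}_{\Psi(x)}$ for $\mu>0$. The value $1/\Gamma(z)$ is $0$ when $z$ is a nonpositive integer. *)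

theory Defs
  imports "HOL-Analysis.Analysis"
begin

definition abs_continuous_on :: "real \<Rightarrow> real \<Rightarrow> (real \<Rightarrow> complex) \<Rightarrow> bool" where
  "abs_continuous_on a b g \<longleftrightarrow>
     (\<forall>\<epsilon>>0. \<exists>\<delta>>0. \<forall>d. d division_of (\<Union>d) \<and> \<Union>d \<subseteq> {a..b} \<and> (\<Sum>K\<in>d. Sup K - Inf K) < \<delta>
        \<longrightarrow> (\<Sum>K\<in>d. norm (g (Sup K) - g (Inf K))) < \<epsilon>)"

text \<open>All derivatives are taken within \<open>{a..b}\<close>, hence one-sided at the endpoints; values
  outside the interval play no role.\<close>

abbreviation deriv_on :: "real \<Rightarrow> real \<Rightarrow> (real \<Rightarrow> 'a::real_normed_vector) \<Rightarrow> real \<Rightarrow> 'a" where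
  "deriv_on a b g x \<equiv> vector_derivative g (at x within {a..b})"

definition C1_on :: "real \<Rightarrow> real \<Rightarrow> (real \<Rightarrow> real) \<Rightarrow> bool" where
  "C1_on a b \<Psi> \<longleftrightarrow>
     (\<forall>x\<in>{a..b}. \<Psi> differentiable (at x within {a..b})) \<and> continuous_on {a..b} (deriv_on a b \<Psi>)"

definition \<Psi>delta :: "real \<Rightarrow> real \<Rightarrow> (real \<Rightarrow> real) \<Rightarrow> (real \<Rightarrow> complex) \<Rightarrow> real \<Rightarrow> complex" where
  "\<Psi>delta a b \<Psi> g x = of_real (\<Psi> x / deriv_on a b \<Psi> x) * deriv_on a b g x"

text \<open>Since \<^const>\<open>vector_derivative\<close> is total, the existence of the lower-order derivatives,
  which is implicit in the formation of the iterated derivative, is demanded explicitly.\<close>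

definition AC_delta ::
  "real \<Rightarrow> real \<Rightarrow> (real \<Rightarrow> real) \<Rightarrow> real \<Rightarrow> nat \<Rightarrow> (real \<Rightarrow> complex) set" where
  "AC_delta a b \<Psi> s n = {h.
     let g = (\<lambda>x. of_real (\<Psi> x powr s) * h x) in
       (\<forall>j<n - 1. \<forall>x\<in>{a..b}. (\<Psi>delta a b \<Psi> ^^ j) g differentiable (at x within {a..b})) \<and>
       abs_continuous_on a b ((\<Psi>delta a b \<Psi> ^^ (n - 1)) g)}"

text \<open>The integral below is over a null set for \<open>x = a\<close>, so that its value there is always 0;
  it is meaningful for \<open>x > a\<close> only.\<close>

definition hadamard_I ::
  "real \<Rightarrow> real \<Rightarrow> (real \<Rightarrow> real) \<Rightarrow> real \<Rightarrow> real \<Rightarrow> (real \<Rightarrow> complex) \<Rightarrow> real \<Rightarrow> complex" where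
  "hadamard_I a b \<Psi> s \<mu> f x =
     of_real (1 / Gamma \<mu>) *
     (LINT t:{a..x}|lebesgue.
        of_real ((\<Psi> t / \<Psi> x) powr s * ln (\<Psi> x / \<Psi> t) powr (\<mu> - 1)) * f t *
        of_real (deriv_on a b \<Psi> t / \<Psi> t))"

definition hadamard_D ::
  "real \<Rightarrow> real \<Rightarrow> (real \<Rightarrow> real) \<Rightarrow> real \<Rightarrow> nat \<Rightarrow> (real \<Rightarrow> complex) \<Rightarrow> real \<Rightarrow> complex" where
  "hadamard_D a b \<Psi> s n f x =
     of_real (\<Psi> x powr (- s)) * (\<Psi>delta a b \<Psi> ^^ n) (\<lambda>y. of_real (\<Psi> y powr s) * f y) x"

definition hadamard_RL ::
  "real \<Rightarrow> real \<Rightarrow> (real \<Rightarrow> real) \<Rightarrow> real \<Rightarrow> real \<Rightarrow> (real \<Rightarrow> complex) \<Rightarrow> real \<Rightarrow> complex" where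
  "hadamard_RL a b \<Psi> s \<mu> f =
     (if \<mu> \<ge> 0 then
        (let n = nat \<lfloor>\<mu>\<rfloor> + 1 in hadamard_D a b \<Psi> s n (hadamard_I a b \<Psi> s (real n - \<mu>) f))
      else hadamard_I a b \<Psi> s (- \<mu>) f)"

end

theory Submission
  imports Defs
begin

text \<open>
  Put \<open>T = ln \<Psi>\<close> and \<open>w = T' = \<Psi>' / \<Psi>\<close>, a positive continuous function, and write
  \<open>J\<^sup>\<beta> \<phi> (x) = 1 / \<Gamma>(\<beta>) \<integral>\<^sub>a\<^sup>x (T x - T t)\<^sup>\<beta>\<^sup>-\<^sup>1 \<phi>(t) dt\<close>. Conjugation by \<open>\<Psi>\<^sup>s\<close> turns the Hadamard integral of
  order \<open>\<beta>\<close> of \<open>f\<close> into \<open>J\<^sup>\<beta> \<phi>\<close> with \<open>\<phi> = w \<Psi>\<^sup>s f\<close>, and the operator \<open>\<delta> = (\<Psi> / \<Psi>') d/dx\<close> is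
  \<open>(1 / w) d/dx\<close>. So the theorem is the classical inversion formula for Riemann-Liouville
  integrals in the time scale \<open>T\<close>.

  Let \<open>G\<^sub>j = \<delta>\<^sup>j (\<Psi>\<^sup>s h)\<close>, where \<open>h\<close> is the representative of the integral of order \<open>n - \<mu>\<close>. The
  regularity hypothesis says \<open>G\<^sub>j(x) = G\<^sub>j(a) + \<integral>\<^sub>a\<^sup>x w G\<^sub>j\<^sub>+\<^sub>1\<close> for \<open>j < n\<close>, and iterating this gives
  Taylor's formula (lemma \<open>taylor\<close>)
  \<open>G\<^sub>0 = \<Sum>\<^sub>j G\<^sub>j(a) (T - T a)\<^sup>j / j! + J\<^sup>n (w G\<^sub>n)\<close>. Let \<open>\<alpha> = n - \<mu>\<close>. If \<open>\<alpha> < 1\<close>, apply \<open>J\<^sup>1\<^sup>-\<^sup>\<alpha>\<close> to \<open>w\<close> times both sides. By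
  the semigroup law \<open>J\<^sup>\<alpha> (w J\<^sup>\<beta> \<phi>) = J\<^sup>\<alpha>\<^sup>+\<^sup>\<beta> \<phi>\<close> (lemma \<open>frac_int_semigroup\<close>) the left side becomes \<open>J\<^sup>1 \<phi>\<close>, the
  remainder becomes \<open>J\<^sup>1 (w J\<^sup>\<mu> (w G\<^sub>n))\<close>, and the powers are \<open>J\<^sup>1\<close> of \<open>w\<close> times powers. Functions with the same
  indefinite integral agree almost everywhere, so \<open>J\<^sup>1\<close> can be cancelled (theorem
  \<open>frac_int_inversion\<close>). The detour through \<open>J\<^sup>1\<close> is deliberate: \<open>J\<^sup>\<alpha> \<phi>\<close> with \<open>\<alpha> < 1\<close> need not
  converge at every point, but the semigroup law holds at every point as soon as \<open>\<alpha> + \<beta> \<ge> 1\<close>.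

  If \<open>\<mu>\<close> is an integer, then \<open>\<alpha> = 1\<close>, and the term \<open>j = 0\<close> would be a multiple of \<open>(T - T a)\<^sup>-\<^sup>1\<close>; its
  coefficient \<open>1 / \<Gamma>(0)\<close> vanishes, in accordance with \<open>G\<^sub>0(a) = 0\<close>, since \<open>G\<^sub>0\<close> is then an indefinite
  integral from \<open>a\<close>.

  The step \<open>j = n - 1\<close> of the hypothesis is the fundamental theorem of calculus for an absolutely
  continuous function, with the pointwise derivative under the integral. It is proved in three
  steps: a Vitali covering argument shows that the derivative exists almost everywhere
  (\<open>ac_real_differentiable_ae\<close>), a gauge argument integrates it (\<open>ac_fundamental_theorem\<close>), and
  bounded variation makes the integral absolutely convergent
  (\<open>ac_derivative_absolutely_integrable\<close>).
\<close>

section \<open>Absolute continuity and Vitali coverings\<close>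

text \<open>
  The same notion as \<^const>\<open>abs_continuous_on\<close>, for an arbitrary normed target: the differentiability
  theorem is about the real and imaginary parts separately.
\<close>

definition ac_on :: "real \<Rightarrow> real \<Rightarrow> (real \<Rightarrow> 'a::real_normed_vector) \<Rightarrow> bool" where
  "ac_on a b g \<longleftrightarrow>
     (\<forall>\<epsilon>>0. \<exists>\<delta>>0. \<forall>d. d division_of (\<Union>d) \<and> \<Union>d \<subseteq> {a..b} \<and> (\<Sum>K\<in>d. Sup K - Inf K) < \<delta>
        \<longrightarrow> (\<Sum>K\<in>d. norm (g (Sup K) - g (Inf K))) < \<epsilon>)"

lemma ac_onD:
  assumes "ac_on a b g" "\<epsilon> > 0"
  shows "\<exists>\<delta>>0. \<forall>d. d division_of (\<Union>d) \<and> \<Union>d \<subseteq> {a..b} \<and> (\<Sum>K\<in>d. Sup K - Inf K) < \<delta>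
        \<longrightarrow> (\<Sum>K\<in>d. norm (g (Sup K) - g (Inf K))) < \<epsilon>"
  using assms unfolding ac_on_def by simp

lemma sum_increments_division:
  fixes H :: "real \<Rightarrow> 'a::real_normed_vector"
  assumes "d division_of {a..b}" "a \<le> b"
  shows "(\<Sum>K\<in>d. H (Sup K) - H (Inf K)) = H b - H a"
proof -
  define g where "g = (\<lambda>S. if S = {} then 0 else H (Sup S) - H (Inf S))"
  interpret g: operative_real plus 0 g
  proof
    show "g {a..b} = 0" if "b \<le> a" for a b :: real
      using that by (cases "a = b") (auto simp: g_def)
    show "g {a..c} + g {c..b} = g {a..b}" if "a < c" "c < b" for a b c :: real
      using that by (auto simp: g_def)
  qed
  have "(\<Sum>K\<in>d. H (Sup K) - H (Inf K)) = sum g d"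
    using assms(1) by (intro sum.cong) (auto simp: g_def dest: division_ofD(3))
  also have "\<dots> = g {a..b}"
    using g.division[of d a b] assms(1) by (simp add: sum_def)
  finally show ?thesis using assms(2) by (auto simp: g_def)
qed

text \<open>
  Vitali's covering theorem gives countably many disjoint intervals that cover \<open>E\<close> up to a null set;
  since they lie in a set of finite measure, finitely many of them miss only a set of measure
  below \<open>e\<close>. The set \<open>N\<close> collects both errors; it is measurable, whereas \<open>E\<close> is an arbitrary set.
\<close>

lemma vitali_finite:
  fixes E G :: "real set"
  assumes G: "open G" "G \<in> lmeasurable" "E \<subseteq> G"
    and P: "\<And>x d. \<lbrakk>x \<in> E; 0 < d\<rbrakk> \<Longrightarrow> \<exists>u v. u < v \<and> v - u < d \<and> x \<in> {u..v} \<and> P u v"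
    and e: "e > 0"
  obtains F N where "F division_of \<Union>F"
    "\<And>K. K \<in> F \<Longrightarrow> \<exists>u v. K = {u..v} \<and> u < v \<and> P u v \<and> K \<subseteq> G"
    "N \<in> lmeasurable" "measure lebesgue N < e" "E \<subseteq> \<Union>F \<union> N"
proof -
  define I where "I = {(u,v). u < v \<and> P u v \<and> {u..v} \<subseteq> G}"
  define c r :: "real \<times> real \<Rightarrow> real" where "c = (\<lambda>(u,v). (u+v)/2)" and "r = (\<lambda>(u,v). (v-u)/2)"
  have cb: "cball (c i) (r i) = {fst i..snd i}" for i
    by (cases i) (auto simp: c_def r_def cball_eq_atLeastAtMost field_simps)
  obtain C where C: "countable C" "C \<subseteq> I"
     "pairwise (\<lambda>i j. disjnt (cball (c i) (r i)) (cball (c j) (r j))) C"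
     "negligible (E - (\<Union>i \<in> C. cball (c i) (r i)))"
  proof (rule Vitali_covering_theorem_cballs[of I r E c])
    show "0 < r i" if "i \<in> I" for i using that by (auto simp: I_def r_def)
    show "\<exists>i. i \<in> I \<and> x \<in> cball (c i) (r i) \<and> r i < d" if "x \<in> E" "0 < d" for x d
    proof -
      obtain m where m: "m > 0" "ball x m \<subseteq> G"
        using G \<open>x \<in> E\<close> by (metis openE subsetD)
      obtain u v where uv: "u < v" "v - u < min d m" "x \<in> {u..v}" "P u v"
        using P[OF \<open>x \<in> E\<close>, of "min d m"] m \<open>d > 0\<close> by auto
      have "{u..v} \<subseteq> ball x m" using uv by (auto simp: dist_real_def)
      then have "(u,v) \<in> I" using uv m by (auto simp: I_def)
      moreover have "r (u,v) < d" using uv by (auto simp: r_def)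
      moreover have "x \<in> cball (c (u,v)) (r (u,v))" using uv by (simp add: cb)
      ultimately show ?thesis by blast
    qed
  qed
  define D where "D = (\<lambda>(u,v). {u..v}) ` C"
  have D: "countable D" "\<And>K. K \<in> D \<Longrightarrow> \<exists>u v. K = {u..v} \<and> u < v \<and> P u v \<and> K \<subseteq> G"
    using C by (auto simp: D_def I_def)
  have Dint: "K \<inter> L = {}" if "K \<in> D" "L \<in> D" "K \<noteq> L" for K L
  proof -
    obtain i j where "i \<in> C" "j \<in> C" "K = {fst i..snd i}" "L = {fst j..snd j}"
      using \<open>K \<in> D\<close> \<open>L \<in> D\<close> by (auto simp: D_def)
    moreover have "i \<noteq> j" using calculation that by auto
    ultimately show ?thesis using pairwiseD[OF C(3), of i j] by (simp add: cb disjnt_def)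
  qed
  have UD: "\<Union>D = (\<Union>i \<in> C. cball (c i) (r i))"
    by (auto simp: D_def cb)
  have Dm: "K \<in> lmeasurable" if "K \<in> D" for K using D(2)[OF that] by auto
  have UDm: "\<Union>D \<in> lmeasurable"
  proof (rule fmeasurableI2[OF G(2)])
    show "\<Union>D \<subseteq> G" using D(2) by blast
    show "\<Union>D \<in> sets lebesgue" using D Dm by (intro sets.countable_Union) (auto intro: fmeasurableD)
  qed
  obtain F where F: "F \<subseteq> D" "finite F" "measure lebesgue (\<Union>D) - e < measure lebesgue (\<Union>F)"
  proof (rule measure_countable_Union_approachable[OF D(1) e Dm])
    show "measure lebesgue (\<Union>D') \<le> measure lebesgue (\<Union>D)" if "D' \<subseteq> D" "finite D'" for D'
      using that UDm Dm by (intro measure_mono_fmeasurable) (auto intro!: sets.finite_Union fmeasurableD)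
  qed
  have UFm: "\<Union>F \<in> lmeasurable" using F Dm by (intro fmeasurable.finite_Union) auto
  define N where "N = (\<Union>D - \<Union>F) \<union> (E - \<Union>D)"
  have neg: "E - \<Union>D \<in> null_sets lebesgue" using C(4) by (simp add: UD negligible_iff_null_sets)
  have "measure lebesgue N = measure lebesgue (\<Union>D - \<Union>F)"
    unfolding N_def using UDm UFm neg by (intro measure_Un_null_set) (auto intro: fmeasurableD)
  also have "\<dots> = measure lebesgue (\<Union>D) - measure lebesgue (\<Union>F)"
    using F UDm UFm by (intro measurable_measure_Diff) (auto intro: fmeasurableD)
  also have "\<dots> < e" using F by linarith
  finally have N: "measure lebesgue N < e" .
  have Nm: "N \<in> lmeasurable"
    unfolding N_def using negligible_imp_measurable[OF C(4)[folded UD]]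
      fmeasurable.Diff[OF UDm UFm] by (intro fmeasurable.Un)
  have "F division_of \<Union>F"
  proof (rule division_ofI)
    show "finite F" by fact
    fix K assume K: "K \<in> F"
    show "K \<subseteq> \<Union>F" using K by auto
    show "K \<noteq> {}" "\<exists>a b. K = cbox a b" using D(2)[of K] K F by force+
    fix L assume "L \<in> F" "K \<noteq> L"
    then have "K \<inter> L = {}" using Dint K F by blast
    then show "interior K \<inter> interior L = {}" using interior_subset by blast
  qed auto
  moreover have "\<exists>u v. K = {u..v} \<and> u < v \<and> P u v \<and> K \<subseteq> G" if "K \<in> F" for K
    using that F(1) D(2) by blast
  moreover have "E \<subseteq> \<Union>F \<union> N" by (auto simp: N_def)
  ultimately show ?thesis using that Nm N by blast
qed

text \<open>
  The number \<open>s\<close> is the outer measure of \<open>E\<close>. Working with it allows covering arguments for sets of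
  points that are described by difference quotients only.
\<close>

lemma outer_measure_approx:
  fixes E :: "real set"
  assumes "E \<subseteq> W" "W \<in> lmeasurable" "open W"
  obtains s where "s \<ge> 0" "\<And>U. \<lbrakk>U \<in> lmeasurable; E \<subseteq> U\<rbrakk> \<Longrightarrow> s \<le> measure lebesgue U"
    "\<And>e. e > 0 \<Longrightarrow> \<exists>U. open U \<and> U \<in> lmeasurable \<and> E \<subseteq> U \<and> U \<subseteq> W \<and> measure lebesgue U < s + e"
proof -
  define A where "A = measure lebesgue ` {U. U \<in> lmeasurable \<and> E \<subseteq> U}"
  have ne: "A \<noteq> {}" using assms by (auto simp: A_def)
  have bdd: "bdd_below A" by (auto simp: A_def intro!: bdd_belowI[of _ 0])
  show ?thesis
  proof (rule that[of "Inf A"])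
    show "Inf A \<ge> 0" using ne by (intro cInf_greatest) (auto simp: A_def)
    show "Inf A \<le> measure lebesgue U" if "U \<in> lmeasurable" "E \<subseteq> U" for U
      using that bdd by (intro cInf_lower) (auto simp: A_def)
    fix e :: real assume "e > 0"
    then have "Inf A < Inf A + e/2" by simp
    then obtain x where x: "x \<in> A" "x < Inf A + e/2" using cInf_lessD[OF ne] by blast
    then obtain U where U: "U \<in> lmeasurable" "E \<subseteq> U" "measure lebesgue U < Inf A + e/2" by (auto simp: A_def)
    obtain T where T: "open T" "U \<subseteq> T" "(T - U) \<in> lmeasurable" "emeasure lebesgue (T - U) < ennreal (e/2)"
      using sets_lebesgue_outer_open[of U "e/2"] U \<open>e > 0\<close> by (auto intro: fmeasurableD)
    have mT: "measure lebesgue (T - U) < e/2"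
      using T(3,4) \<open>e > 0\<close> by (simp add: emeasure_eq_measure2 ennreal_less_iff)
    have TU: "T = U \<union> (T - U)" using T by auto
    have "T \<in> lmeasurable" using TU T(3) U(1) fmeasurable.Un by metis
    moreover have "measure lebesgue T \<le> measure lebesgue U + measure lebesgue (T - U)"
      using TU T(3) U(1) by (metis fmeasurableD measure_Un_le)
    moreover have "measure lebesgue (T \<inter> W) \<le> measure lebesgue T"
      using \<open>T \<in> lmeasurable\<close> assms by (intro measure_mono_fmeasurable) (auto intro: fmeasurableD)
    ultimately show "\<exists>U. open U \<and> U \<in> lmeasurable \<and> E \<subseteq> U \<and> U \<subseteq> W \<and> measure lebesgue U < Inf A + e"
      using T assms mT U by (intro exI[of _ "T \<inter> W"]) (auto intro: fmeasurable.Int)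
  qed
qed

text \<open>
  The intervals of \<open>F\<close> are divided into those of \<open>F'\<close> and a remainder \<open>R\<close>, and increments are
  additive. With the identity for \<open>H\<close> the formula compares total lengths, so that one and the same
  \<open>R\<close> relates lengths and increments.
\<close>

lemma division_subtract_refinement:
  fixes F F' :: "real set set"
  assumes F: "F division_of \<Union>F" and F': "F' division_of \<Union>F'"
    and sub: "\<And>J. J \<in> F' \<Longrightarrow> interior J \<noteq> {} \<and> (\<exists>K\<in>F. J \<subseteq> K)"
  shows "\<exists>R. R division_of \<Union>R \<and> \<Union>R \<subseteq> \<Union>F \<and>
    (\<forall>H :: real \<Rightarrow> real. (\<Sum>K\<in>F. H (Sup K) - H (Inf K)) =
       (\<Sum>K\<in>F'. H (Sup K) - H (Inf K)) + (\<Sum>K\<in>R. H (Sup K) - H (Inf K)))"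
proof -
  define A where "A = (\<lambda>K. {J \<in> F'. J \<subseteq> K})"
  have "\<exists>q. A K \<subseteq> q \<and> q division_of K" if "K \<in> F" for K
  proof -
    obtain u v where K: "K = cbox u v" using division_ofD(4)[OF F \<open>K \<in> F\<close>] by blast
    have "A K division_of \<Union>(A K)" by (rule division_of_subset[OF F']) (auto simp: A_def)
    moreover have "\<Union>(A K) \<subseteq> cbox u v" by (auto simp: A_def K)
    ultimately obtain q where "A K \<subseteq> q" "q division_of cbox u v"
      by (rule partial_division_extend_interval)
    then show ?thesis unfolding K by blast
  qed
  then obtain q where q: "\<And>K. K \<in> F \<Longrightarrow> A K \<subseteq> q K" "\<And>K. K \<in> F \<Longrightarrow> q K division_of K"
    by metis
  define R where "R = (\<lambda>K. {J \<in> q K - A K. interior J \<noteq> {}})"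
  have fin: "finite F" "finite F'" "\<And>K. K \<in> F \<Longrightarrow> finite (q K)"
    using division_of_finite[OF F] division_of_finite[OF F'] division_of_finite[OF q(2)] by auto
  have Rq: "J \<in> q K" "J \<subseteq> K" if "J \<in> R K" "K \<in> F" for J K
    using that q(2)[of K] by (auto simp: R_def)
  have dis: "interior J \<inter> interior L = {}" if "J \<subseteq> K" "L \<subseteq> K'" "K \<in> F" "K' \<in> F" "K \<noteq> K'" for J L K K'
    using that division_ofD(5)[OF F, of K K'] interior_mono by blast
  have "(\<Union>K\<in>F. R K) division_of \<Union>(\<Union>K\<in>F. R K)"
  proof (rule division_ofI)
    show "finite (\<Union>K\<in>F. R K)" using fin by (auto simp: R_def)
    fix J assume J: "J \<in> (\<Union>K\<in>F. R K)"
    then obtain K where K: "K \<in> F" "J \<in> R K" by auto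
    show "J \<subseteq> \<Union>(\<Union>K\<in>F. R K)" using J by auto
    show "J \<noteq> {}" "\<exists>a b. J = cbox a b" using division_ofD(3,4)[OF q(2)[OF K(1)]] Rq[OF K(2,1)] by auto
    fix L assume "L \<in> (\<Union>K\<in>F. R K)" "J \<noteq> L"
    then obtain K' where K': "K' \<in> F" "L \<in> R K'" by auto
    show "interior J \<inter> interior L = {}"
    proof (cases "K = K'")
      case True
      show ?thesis
        using division_ofD(5)[OF q(2)[OF K(1)]] Rq(1)[OF K(2,1)] Rq(1)[OF K'(2,1)] \<open>J \<noteq> L\<close> True by auto
    next
      case False
      then show ?thesis using dis[of J K L K'] K K' Rq by blast
    qed
  qed auto
  moreover have "\<Union>(\<Union>K\<in>F. R K) \<subseteq> \<Union>F" using Rq by blast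
  moreover have "(\<Sum>K\<in>F. H (Sup K) - H (Inf K)) =
       (\<Sum>K\<in>F'. H (Sup K) - H (Inf K)) + (\<Sum>K\<in>(\<Union>K\<in>F. R K). H (Sup K) - H (Inf K))" for H :: "real \<Rightarrow> real"
  proof -
    let ?h = "\<lambda>K. H (Sup K) - H (Inf K)"
    have *: "?h K = sum ?h (A K) + sum ?h (R K)" if K: "K \<in> F" for K
    proof -
      obtain u v where uv: "K = {u..v}" "u \<le> v"
        using division_ofD(3,4)[OF F K] by auto
      have "?h K = sum ?h (q K)"
        using sum_increments_division[of "q K" u v H] q(2)[OF K] uv by simp
      also have "\<dots> = sum ?h (A K \<union> R K)"
      proof (rule sum.mono_neutral_right)
        show "\<forall>i\<in>q K - (A K \<union> R K). ?h i = 0"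
        proof
          fix J assume J: "J \<in> q K - (A K \<union> R K)"
          then obtain c d where "J = {c..d}" "c \<le> d"
            using division_ofD(3,4)[OF q(2)[OF K], of J] by auto
          with J show "?h J = 0" by (auto simp: R_def)
        qed
      qed (use q fin K in \<open>auto simp: R_def\<close>)
      also have "\<dots> = sum ?h (A K) + sum ?h (R K)"
        using fin K by (intro sum.union_disjoint) (auto simp: R_def A_def)
      finally show ?thesis .
    qed
    have AU: "(\<Union>K\<in>F. A K) = F'" using sub by (auto simp: A_def)
    have "(\<Sum>K\<in>F. ?h K) = (\<Sum>K\<in>F. sum ?h (A K)) + (\<Sum>K\<in>F. sum ?h (R K))"
      using * by (simp add: sum.distrib[symmetric])
    also have "(\<Sum>K\<in>F. sum ?h (A K)) = sum ?h (\<Union>K\<in>F. A K)"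
    proof (rule sum.UNION_disjoint[symmetric])
      show "\<forall>i\<in>F. \<forall>j\<in>F. i \<noteq> j \<longrightarrow> A i \<inter> A j = {}"
      proof (intro ballI impI equals0I)
        fix K K' J assume "K \<in> F" "K' \<in> F" "K \<noteq> K'" "J \<in> A K \<inter> A K'"
        then show False using dis[of J K J K'] sub[of J] by (auto simp: A_def)
      qed
    qed (use fin in \<open>auto simp: A_def\<close>)
    also have "(\<Sum>K\<in>F. sum ?h (R K)) = sum ?h (\<Union>K\<in>F. R K)"
    proof (rule sum.UNION_disjoint[symmetric])
      show "\<forall>i\<in>F. \<forall>j\<in>F. i \<noteq> j \<longrightarrow> R i \<inter> R j = {}"
      proof (intro ballI impI equals0I)
        fix K K' J assume *: "K \<in> F" "K' \<in> F" "K \<noteq> K'" "J \<in> R K \<inter> R K'"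
        then have "interior J = {}" using dis[of J K J K'] Rq(2)[of J] by auto
        with * show False by (auto simp: R_def)
      qed
    qed (use fin in \<open>auto simp: R_def\<close>)
    finally show ?thesis by (simp add: AU)
  qed
  ultimately show ?thesis by blast
qed

lemma measure_division:
  fixes F :: "real set set"
  assumes "F division_of \<Union>F"
  shows "\<Union>F \<in> lmeasurable" "measure lebesgue (\<Union>F) = (\<Sum>K\<in>F. Sup K - Inf K)"
proof -
  show "\<Union>F \<in> lmeasurable" using assms by (rule lmeasurable_division)
  have "measure lebesgue (\<Union>F) = (\<Sum>K\<in>F. measure lebesgue K)"
    using content_division[OF assms] by simp
  also have "\<dots> = (\<Sum>K\<in>F. Sup K - Inf K)"
    using division_ofD(3,4)[OF assms] by (intro sum.cong) force+
  finally show "measure lebesgue (\<Union>F) = (\<Sum>K\<in>F. Sup K - Inf K)" .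
qed

text \<open>
  Suppose that \<open>E\<close> had outer measure \<open>s > 0\<close>. Cover \<open>E\<close> by intervals \<open>F\<close> of slope at most \<open>-\<kappa>\<close>, of total
  length close to \<open>s\<close>, and then cover the part of \<open>E\<close> inside \<open>F\<close> by smaller intervals \<open>F'\<close> of slope at
  least \<open>\<kappa>\<close>, again of total length close to \<open>s\<close>. What is left of \<open>F\<close> is short, so by absolute continuity
  it hardly contributes to the increment of \<open>H\<close>. Hence the total increment over \<open>F\<close> is at most
  about \<open>-\<kappa> s\<close> and at least about \<open>\<kappa> s\<close>.
\<close>

lemma ac_mixed_slopes_negligible:
  fixes H :: "real \<Rightarrow> real"
  assumes ac: "ac_on a b H" and \<kappa>: "\<kappa> > 0" and E: "E \<subseteq> {a<..<b}"
    and lo: "\<And>x d. \<lbrakk>x \<in> E; 0 < d\<rbrakk> \<Longrightarrow> \<exists>u v. u < v \<and> v - u < d \<and> x \<in> {u..v} \<and> H v - H u \<le> - \<kappa> * (v - u)"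
    and hi: "\<And>x d. \<lbrakk>x \<in> E; 0 < d\<rbrakk> \<Longrightarrow> \<exists>u v. u < v \<and> v - u < d \<and> x \<in> {u..v} \<and> \<kappa> * (v - u) \<le> H v - H u"
  shows "negligible E"
proof -
  obtain s where s: "s \<ge> 0" "\<And>U. \<lbrakk>U \<in> lmeasurable; E \<subseteq> U\<rbrakk> \<Longrightarrow> s \<le> measure lebesgue U"
    "\<And>e. e > 0 \<Longrightarrow> \<exists>U. open U \<and> U \<in> lmeasurable \<and> E \<subseteq> U \<and> U \<subseteq> {a<..<b} \<and> measure lebesgue U < s + e"
    using outer_measure_approx[OF E] by auto
  have "s = 0"
  proof (rule ccontr)
    assume "s \<noteq> 0"
    with s(1) have s0: "s > 0" by simp
    define \<eta> where "\<eta> = \<kappa> * s / 8"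
    have "\<eta> > 0" using s0 \<kappa> by (simp add: \<eta>_def)
    obtain \<delta> where \<delta>: "\<delta> > 0" "\<forall>d. d division_of (\<Union>d) \<and> \<Union>d \<subseteq> {a..b} \<and> (\<Sum>K\<in>d. Sup K - Inf K) < \<delta>
        \<longrightarrow> (\<Sum>K\<in>d. norm (H (Sup K) - H (Inf K))) < \<eta>"
      using ac_onD[OF ac \<open>\<eta> > 0\<close>] by blast
    define \<epsilon> where "\<epsilon> = min (s/16) (\<delta>/8)"
    have \<epsilon>: "\<epsilon> > 0" "\<epsilon> \<le> s/16" "\<epsilon> \<le> \<delta>/8" using s0 \<delta> by (auto simp: \<epsilon>_def)
    obtain U where U: "open U" "U \<in> lmeasurable" "E \<subseteq> U" "U \<subseteq> {a<..<b}" "measure lebesgue U < s + \<epsilon>"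
      using s(3)[OF \<epsilon>(1)] by blast
    obtain F N where F: "F division_of \<Union>F"
      "\<And>K. K \<in> F \<Longrightarrow> \<exists>u v. K = {u..v} \<and> u < v \<and> H v - H u \<le> - \<kappa> * (v - u) \<and> K \<subseteq> U"
      and N: "N \<in> lmeasurable" "measure lebesgue N < \<epsilon>" "E \<subseteq> \<Union>F \<union> N"
      by (rule vitali_finite[OF U(1-3) lo \<epsilon>(1)]) blast+
    define W where "W = (\<Union>K\<in>F. interior K)"
    have W: "open W" "W \<in> lmeasurable" "E \<inter> W \<subseteq> W"
      using F(1) by (auto simp: W_def intro!: fmeasurable.finite_UN lmeasurable_interior dest: division_ofD(4))
    have hi': "\<exists>u v. u < v \<and> v - u < d \<and> x \<in> {u..v} \<and> (\<kappa> * (v - u) \<le> H v - H u \<and> (\<exists>K\<in>F. {u..v} \<subseteq> K))"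
      if x: "x \<in> E \<inter> W" and d: "0 < d" for x d
    proof -
      obtain K where K: "K \<in> F" "x \<in> interior K" using x by (auto simp: W_def)
      then obtain m where m: "m > 0" "ball x m \<subseteq> K" by (meson mem_interior)
      obtain u v where uv: "u < v" "v - u < min d m" "x \<in> {u..v}" "\<kappa> * (v - u) \<le> H v - H u"
        using hi[of x "min d m"] x d m by auto
      have "{u..v} \<subseteq> ball x m" using uv by (auto simp: dist_real_def)
      with uv m K show ?thesis by (intro exI[of _ u] exI[of _ v]) auto
    qed
    obtain F' N' where F': "F' division_of \<Union>F'"
      "\<And>K. K \<in> F' \<Longrightarrow> \<exists>u v. K = {u..v} \<and> u < v \<and> (\<kappa> * (v - u) \<le> H v - H u \<and> (\<exists>K\<in>F. {u..v} \<subseteq> K)) \<and> K \<subseteq> W"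
      and N': "N' \<in> lmeasurable" "measure lebesgue N' < \<epsilon>" "E \<inter> W \<subseteq> \<Union>F' \<union> N'"
      by (rule vitali_finite[OF W hi' \<epsilon>(1)]) blast+
    let ?l = "\<lambda>F. \<Sum>K\<in>F. Sup K - Inf K" and ?h = "\<lambda>F. \<Sum>K\<in>F. H (Sup K) - H (Inf K)"
    have sub: "interior J \<noteq> {} \<and> (\<exists>K\<in>F. J \<subseteq> K)" if "J \<in> F'" for J
      using F'(2)[OF that] by auto
    obtain R where R: "R division_of \<Union>R" "\<Union>R \<subseteq> \<Union>F"
      "\<forall>H :: real \<Rightarrow> real. (\<Sum>K\<in>F. H (Sup K) - H (Inf K)) =
       (\<Sum>K\<in>F'. H (Sup K) - H (Inf K)) + (\<Sum>K\<in>R. H (Sup K) - H (Inf K))"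
      using division_subtract_refinement[OF F(1) F'(1) sub] by auto
    have UFm: "\<Union>F \<in> lmeasurable" "\<Union>F' \<in> lmeasurable"
      using measure_division F F' by auto
    have "\<Union>F \<subseteq> U" using F(2) by blast
    then have "measure lebesgue (\<Union>F) \<le> measure lebesgue U"
      using UFm U by (intro measure_mono_fmeasurable) (auto intro: fmeasurableD)
    then have lF: "?l F < s + \<epsilon>" using measure_division(2)[OF F(1)] U by linarith
    have fin: "finite (\<Union>F - W)"
    proof -
      have "\<Union>F - W \<subseteq> (\<Union>K\<in>F. {Inf K, Sup K})"
      proof
        fix x assume x: "x \<in> \<Union>F - W"
        then obtain K where K: "K \<in> F" "x \<in> K" "x \<notin> interior K" by (auto simp: W_def)
        moreover obtain u v where "K = {u..v}" "u < v" using F(2)[OF K(1)] by auto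
        ultimately show "x \<in> (\<Union>K\<in>F. {Inf K, Sup K})" by (intro UN_I[of K]) auto
      qed
      moreover have "finite (\<Union>K\<in>F. {Inf K, Sup K})" using F(1) by auto
      ultimately show ?thesis by (rule finite_subset)
    qed
    have null: "negligible (\<Union>F - W)" using fin by (rule negligible_finite)
    have "s \<le> measure lebesgue ((\<Union>F' \<union> (N \<union> N')) \<union> (\<Union>F - W))"
      using N N' UFm negligible_imp_measurable[OF null] by (intro s(2) fmeasurable.Un) auto
    also have "\<dots> \<le> measure lebesgue (\<Union>F' \<union> (N \<union> N')) + measure lebesgue (\<Union>F - W)"
      using N N' UFm negligible_imp_measurable[OF null]
      by (intro measure_Un_le) (auto intro: fmeasurableD)
    also have "measure lebesgue (\<Union>F - W) = 0" using null by (rule negligible_imp_measure0)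
    also have "measure lebesgue (\<Union>F' \<union> (N \<union> N')) \<le> measure lebesgue (\<Union>F') + measure lebesgue (N \<union> N')"
      using N N' UFm by (intro measure_Un_le) (auto intro: fmeasurableD)
    also have "measure lebesgue (N \<union> N') \<le> measure lebesgue N + measure lebesgue N'"
      using N N' UFm by (intro measure_Un_le) (auto intro: fmeasurableD)
    finally have lF': "s - 2 * \<epsilon> < ?l F'"
      using N N' measure_division(2)[OF F'(1)] by linarith
    \<comment> \<open>The remainder is shorter than \<open>3 \<epsilon>\<close>, hence shorter than \<open>\<delta>\<close>.\<close>
    have lR: "?l F = ?l F' + ?l R" using R(3)[THEN spec, of "\<lambda>x. x"] .
    have "(\<Sum>K\<in>R. norm (H (Sup K) - H (Inf K))) < \<eta>"
    proof (rule \<delta>(2)[rule_format], intro conjI R(1))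
      show "\<Union>R \<subseteq> {a..b}" using R(2) \<open>\<Union>F \<subseteq> U\<close> U(4) by (meson greaterThanLessThan_subseteq_atLeastAtMost_iff order_trans order_refl)
      show "?l R < \<delta>" using lR lF lF' \<epsilon> \<delta> by linarith
    qed
    then have "norm (?h R) < \<eta>" by (meson le_less_trans sum_norm_le order_refl)
    then have hR: "?h R > - \<eta>" by (auto simp: abs_real_def split: if_splits)
    have "?h F \<le> (\<Sum>K\<in>F. - \<kappa> * (Sup K - Inf K))"
      using F(2) by (intro sum_mono) force
    then have hF: "?h F \<le> - \<kappa> * ?l F" by (simp add: sum_distrib_left)
    have "(\<Sum>K\<in>F'. \<kappa> * (Sup K - Inf K)) \<le> ?h F'"
      using F'(2) by (intro sum_mono) force
    then have hF': "\<kappa> * ?l F' \<le> ?h F'" by (simp add: sum_distrib_left)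
    have "\<kappa> * (?l F + ?l F') < \<eta>" using R(3)[THEN spec, of H] hR hF hF' by (simp add: algebra_simps)
    moreover have "\<kappa> * s \<le> \<kappa> * (?l F + ?l F')"
    proof (rule mult_left_mono)
      have "?l R \<ge> 0" using division_ofD(3,4)[OF R(1)] by (intro sum_nonneg) force
      then show "s \<le> ?l F + ?l F'" using lF' lR \<epsilon> s0 by linarith
    qed (use \<kappa> in simp)
    moreover have "\<eta> \<le> \<kappa> * s" using \<kappa> s0 by (simp add: \<eta>_def)
    ultimately show False by linarith
  qed
  show ?thesis unfolding negligible_outer
  proof (intro allI impI)
    fix e :: real assume "e > 0"
    from s(3)[OF this] show "\<exists>T. E \<subseteq> T \<and> T \<in> lmeasurable \<and> measure lebesgue T < e"
      using \<open>s = 0\<close> by auto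
  qed
qed

section \<open>Absolutely continuous functions are differentiable almost everywhere\<close>

lemma ac_on_minus_linear:
  fixes H :: "real \<Rightarrow> real"
  assumes "ac_on a b H"
  shows "ac_on a b (\<lambda>x. H x - c * x)"
  unfolding ac_on_def
proof (intro allI impI)
  fix \<epsilon> :: real assume "\<epsilon> > 0"
  then have "\<epsilon>/2 > 0" by simp
  then obtain \<delta> where \<delta>: "\<delta> > 0" "\<forall>d. d division_of (\<Union>d) \<and> \<Union>d \<subseteq> {a..b} \<and> (\<Sum>K\<in>d. Sup K - Inf K) < \<delta>
        \<longrightarrow> (\<Sum>K\<in>d. norm (H (Sup K) - H (Inf K))) < \<epsilon>/2"
    using ac_onD[OF assms] by blast
  show "\<exists>\<delta>>0. \<forall>d. d division_of (\<Union>d) \<and> \<Union>d \<subseteq> {a..b} \<and> (\<Sum>K\<in>d. Sup K - Inf K) < \<delta>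
        \<longrightarrow> (\<Sum>K\<in>d. norm (H (Sup K) - c * Sup K - (H (Inf K) - c * Inf K))) < \<epsilon>"
  proof (intro exI conjI allI impI)
    let ?\<delta> = "min \<delta> (\<epsilon> / (2 * (\<bar>c\<bar> + 1)))"
    show "?\<delta> > 0" using \<delta> \<open>\<epsilon> > 0\<close> by simp
    fix d :: "real set set"
    assume d: "d division_of (\<Union>d) \<and> \<Union>d \<subseteq> {a..b} \<and> (\<Sum>K\<in>d. Sup K - Inf K) < ?\<delta>"
    have "(\<Sum>K\<in>d. norm (H (Sup K) - c * Sup K - (H (Inf K) - c * Inf K)))
        \<le> (\<Sum>K\<in>d. norm (H (Sup K) - H (Inf K)) + \<bar>c\<bar> * (Sup K - Inf K))"
    proof (rule sum_mono)
      fix K assume "K \<in> d"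
      then obtain u v where K: "K = {u..v}" "u \<le> v"
        using division_ofD(3,4)[of d "\<Union>d" K] d by auto
      have "H v - c * v - (H u - c * u) = (H v - H u) - c * (v - u)" by (simp add: algebra_simps)
      then have "norm (H v - c * v - (H u - c * u)) \<le> norm (H v - H u) + norm (c * (v - u))"
        by (metis norm_triangle_ineq4)
      then show "norm (H (Sup K) - c * Sup K - (H (Inf K) - c * Inf K)) \<le> norm (H (Sup K) - H (Inf K)) + \<bar>c\<bar> * (Sup K - Inf K)"
        using K by (simp add: abs_mult)
    qed
    also have "\<dots> = (\<Sum>K\<in>d. norm (H (Sup K) - H (Inf K))) + \<bar>c\<bar> * (\<Sum>K\<in>d. Sup K - Inf K)"
      by (simp add: sum.distrib sum_distrib_left)
    also have "(\<Sum>K\<in>d. norm (H (Sup K) - H (Inf K))) < \<epsilon>/2"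
      using d by (intro \<delta>(2)[rule_format]) auto
    also have "\<bar>c\<bar> * (\<Sum>K\<in>d. Sup K - Inf K) \<le> \<bar>c\<bar> * (\<epsilon> / (2 * (\<bar>c\<bar> + 1)))"
      using d by (intro mult_left_mono) auto
    also have "\<dots> \<le> \<epsilon>/2" using \<open>\<epsilon> > 0\<close> by (simp add: field_simps)
    finally show "(\<Sum>K\<in>d. norm (H (Sup K) - c * Sup K - (H (Inf K) - c * Inf K))) < \<epsilon>" by simp
  qed
qed

text \<open>
  Locally the variation of \<open>H\<close> is at most \<open>1\<close>, whereas a covering by intervals of slope \<open>\<kappa>\<close> and total
  length \<open>l\<close> produces variation \<open>\<kappa> l\<close>; so \<open>l \<le> 1 / \<kappa>\<close> for every \<open>\<kappa>\<close>.
\<close>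

lemma ac_infinite_slopes_negligible:
  fixes H :: "real \<Rightarrow> real"
  assumes ac: "ac_on a b H" and E: "E \<subseteq> {a<..<b}"
    and slope: "\<And>x d \<kappa>. \<lbrakk>x \<in> E; 0 < d\<rbrakk> \<Longrightarrow> \<exists>u v. u < v \<and> v - u < d \<and> x \<in> {u..v} \<and> \<kappa> * (v - u) \<le> \<bar>H v - H u\<bar>"
  shows "negligible E"
proof (subst locally_negligible_alt, rule ballI)
  fix z assume z: "z \<in> E"
  obtain \<delta> where \<delta>: "\<delta> > 0" "\<forall>d. d division_of (\<Union>d) \<and> \<Union>d \<subseteq> {a..b} \<and> (\<Sum>K\<in>d. Sup K - Inf K) < \<delta>
        \<longrightarrow> (\<Sum>K\<in>d. norm (H (Sup K) - H (Inf K))) < 1"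
    using ac_onD[OF ac zero_less_one] by blast
  define W where "W = ball z (\<delta>/3) \<inter> {a<..<b}"
  have W: "open W" "W \<in> lmeasurable" "E \<inter> ball z (\<delta>/3) \<subseteq> W"
    using E by (auto simp: W_def intro: fmeasurable.Int)
  have "negligible (E \<inter> ball z (\<delta>/3))"
    unfolding negligible_outer
  proof (intro allI impI)
    fix e :: real assume "e > 0"
    then have e2: "e/2 > 0" by simp
    have sl: "\<exists>u v. u < v \<and> v - u < d \<and> x \<in> {u..v} \<and> (2/e) * (v - u) \<le> \<bar>H v - H u\<bar>"
      if "x \<in> E \<inter> ball z (\<delta>/3)" "0 < d" for x d using slope[of x d "2/e"] that by auto
    obtain F N where F: "F division_of \<Union>F"
      "\<And>K. K \<in> F \<Longrightarrow> \<exists>u v. K = {u..v} \<and> u < v \<and> (2/e) * (v - u) \<le> \<bar>H v - H u\<bar> \<and> K \<subseteq> W"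
      and N: "N \<in> lmeasurable" "measure lebesgue N < e/2" "E \<inter> ball z (\<delta>/3) \<subseteq> \<Union>F \<union> N"
      by (rule vitali_finite[OF W sl e2]) blast+
    have FW: "\<Union>F \<subseteq> W" using F(2) by blast
    have UF: "\<Union>F \<in> lmeasurable" by (rule measure_division[OF F(1)])
    have "measure lebesgue (\<Union>F) \<le> measure lebesgue (ball z (\<delta>/3))"
      using FW UF by (intro measure_mono_fmeasurable) (auto simp: W_def intro: fmeasurableD)
    also have "\<dots> = 2 * \<delta> / 3" using \<delta> by (simp add: ball_eq_greaterThanLessThan)
    finally have l: "(\<Sum>K\<in>F. Sup K - Inf K) < \<delta>" using measure_division(2)[OF F(1)] \<delta> by simp
    have "(2/e) * (\<Sum>K\<in>F. Sup K - Inf K) \<le> (\<Sum>K\<in>F. norm (H (Sup K) - H (Inf K)))"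
      unfolding sum_distrib_left using F(2) by (intro sum_mono) force
    also have "\<dots> < 1" using FW l F(1) by (intro \<delta>(2)[rule_format]) (auto simp: W_def)
    finally have "(\<Sum>K\<in>F. Sup K - Inf K) < e/2" using \<open>e > 0\<close> by (simp add: field_simps)
    then have "measure lebesgue (\<Union>F) + measure lebesgue N < e"
      using measure_division(2)[OF F(1)] N by simp
    moreover have "measure lebesgue (\<Union>F \<union> N) \<le> measure lebesgue (\<Union>F) + measure lebesgue N"
      using UF N by (intro measure_Un_le) (auto intro: fmeasurableD)
    ultimately show "\<exists>T. E \<inter> ball z (\<delta>/3) \<subseteq> T \<and> T \<in> lmeasurable \<and> measure lebesgue T < e"
      using N UF by (intro exI[of _ "\<Union>F \<union> N"]) (auto intro: fmeasurable.Un)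
  qed
  then show "\<exists>U. openin (top_of_set E) U \<and> z \<in> U \<and> negligible U"
    using z \<delta> by (intro exI[of _ "E \<inter> ball z (\<delta>/3)"]) (auto intro: openin_open_Int)
qed

lemma slope_interval:
  fixes H :: "real \<Rightarrow> real"
  assumes "h \<noteq> 0" "\<bar>h\<bar> < d" "R ((H (x + h) - H x) / h)"
  shows "\<exists>u v. u < v \<and> v - u < d \<and> x \<in> {u..v} \<and> R ((H v - H u) / (v - u))"
proof (cases "h > 0")
  case True
  then show ?thesis using assms by (intro exI[of _ x] exI[of _ "x + h"]) auto
next
  case False
  have "(H x - H (x + h)) / (x - (x + h)) = (H (x + h) - H x) / h"
    using assms(1) by (simp add: field_simps)
  then show ?thesis using assms False by (intro exI[of _ "x + h"] exI[of _ x]) auto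
qed

text \<open>
  If \<open>H\<close> has no derivative at \<open>x\<close>, then the difference quotients are unbounded, or their lower and
  upper limits are separated by two rationals \<open>p < q\<close>. The first alternative is excluded by the
  previous lemma. In the second one, subtracting the linear function of slope \<open>(p + q) / 2\<close> makes the
  two slopes opposite.
\<close>

theorem ac_real_differentiable_ae:
  fixes H :: "real \<Rightarrow> real"
  assumes ac: "ac_on a b H"
  shows "negligible {x \<in> {a<..<b}. \<not> H differentiable (at x)}"
proof -
  define S where "S = (\<lambda>R x. \<forall>d>0. \<exists>u v. u < v \<and> v - u < d \<and> x \<in> {u..v} \<and> R ((H v - H u) / (v - u)))"
  define E where "E = (\<lambda>(p,q). {x \<in> {a<..<b}. S (\<lambda>y. y \<le> p) x \<and> S (\<lambda>y. q \<le> y) x})"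
  define Z where "Z = {x \<in> {a<..<b}. \<forall>\<kappa>. S (\<lambda>y. \<kappa> \<le> \<bar>y\<bar>) x}"
  have E: "negligible (E (p,q))" if "p < q" for p q
  proof (rule ac_mixed_slopes_negligible[OF ac_on_minus_linear[OF ac, of "(p+q)/2"]])
    show "(q - p)/2 > 0" using that by simp
    show "E (p,q) \<subseteq> {a<..<b}" by (auto simp: E_def)
    fix x d :: real assume *: "x \<in> E (p,q)" "d > 0"
    then obtain u v where uv: "u < v" "v - u < d" "x \<in> {u..v}" "(H v - H u) / (v - u) \<le> p"
      by (force simp: E_def S_def)
    then have "H v - H u \<le> p * (v - u)" by (simp add: divide_le_eq)
    then have "H v - (p+q)/2 * v - (H u - (p+q)/2 * u) \<le> - ((q - p)/2) * (v - u)" by (simp add: field_simps)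
    with uv show "\<exists>u v. u < v \<and> v - u < d \<and> x \<in> {u..v} \<and>
      H v - (p+q)/2 * v - (H u - (p+q)/2 * u) \<le> - ((q - p)/2) * (v - u)" by blast
    obtain u v where uv: "u < v" "v - u < d" "x \<in> {u..v}" "q \<le> (H v - H u) / (v - u)"
      using * by (force simp: E_def S_def)
    then have "q * (v - u) \<le> H v - H u" by (simp add: le_divide_eq)
    then have "((q - p)/2) * (v - u) \<le> H v - (p+q)/2 * v - (H u - (p+q)/2 * u)" by (simp add: field_simps)
    with uv show "\<exists>u v. u < v \<and> v - u < d \<and> x \<in> {u..v} \<and>
      ((q - p)/2) * (v - u) \<le> H v - (p+q)/2 * v - (H u - (p+q)/2 * u)" by blast
  qed
  have Z: "negligible Z"
  proof (rule ac_infinite_slopes_negligible[OF ac])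
    show "Z \<subseteq> {a<..<b}" by (auto simp: Z_def)
    fix x d \<kappa> :: real assume *: "x \<in> Z" "d > 0"
    then obtain u v where uv: "u < v" "v - u < d" "x \<in> {u..v}" "\<kappa> \<le> \<bar>(H v - H u) / (v - u)\<bar>"
      unfolding Z_def S_def by blast
    then have "\<kappa> * (v - u) \<le> \<bar>H v - H u\<bar>" by (simp add: abs_divide le_divide_eq)
    with uv show "\<exists>u v. u < v \<and> v - u < d \<and> x \<in> {u..v} \<and> \<kappa> * (v - u) \<le> \<bar>H v - H u\<bar>" by blast
  qed
  have "{x \<in> {a<..<b}. \<not> H differentiable (at x)} \<subseteq> Z \<union> \<Union>(E ` {(p,q). p \<in> \<rat> \<and> q \<in> \<rat> \<and> p < q})"
  proof
    fix x assume "x \<in> {x \<in> {a<..<b}. \<not> H differentiable (at x)}"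
    then have x: "x \<in> {a<..<b}" "\<not> H differentiable (at x)" by auto
    show "x \<in> Z \<union> \<Union>(E ` {(p,q). p \<in> \<rat> \<and> q \<in> \<rat> \<and> p < q})"
    proof (rule ccontr)
      assume n: "x \<notin> Z \<union> \<Union>(E ` {(p,q). p \<in> \<rat> \<and> q \<in> \<rat> \<and> p < q})"
      define Q where "Q = (\<lambda>h. (H (x + h) - H x) / h)"
      have freq: "S R x" if "\<not> eventually (\<lambda>h. \<not> R (Q h)) (at 0)" for R
        unfolding S_def
      proof (intro allI impI)
        fix d :: real assume "d > 0"
        with that obtain h where "h \<noteq> 0" "\<bar>h\<bar> < d" "R (Q h)"
          unfolding eventually_at by (auto simp: dist_real_def)
        then show "\<exists>u v. u < v \<and> v - u < d \<and> x \<in> {u..v} \<and> R ((H v - H u) / (v - u))"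
          unfolding Q_def by (intro slope_interval)
      qed
      obtain \<kappa> where "\<not> S (\<lambda>y. \<kappa> \<le> \<bar>y\<bar>) x" using n x by (auto simp: Z_def)
      then have bd: "eventually (\<lambda>h. \<not> \<kappa> \<le> \<bar>Q h\<bar>) (at 0)"
        using freq[of "\<lambda>y. \<kappa> \<le> \<bar>y\<bar>"] by argo
      define l L where "l = Liminf (at 0) (\<lambda>h. ereal (Q h))" and "L = Limsup (at 0) (\<lambda>h. ereal (Q h))"
      have "l \<le> L" unfolding l_def L_def by (intro Liminf_le_Limsup) auto
      moreover have "\<not> l < L"
      proof
        assume "l < L"
        then obtain z where z: "l < ereal z" "ereal z < L" using ereal_dense2 by blast
        obtain w where w: "ereal z < ereal w" "ereal w < L" using ereal_dense2[OF z(2)] by blast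
        obtain p where p: "p \<in> \<rat>" "z < p" "p < w" using Rats_dense_in_real[of z w] w by auto
        obtain q where q: "q \<in> \<rat>" "p < q" "q < w" using Rats_dense_in_real[OF p(3)] by auto
        have "S (\<lambda>y. y \<le> p) x"
        proof (rule freq, rule notI)
          assume "\<forall>\<^sub>F h in at 0. \<not> Q h \<le> p"
          then have "\<forall>\<^sub>F h in at 0. ereal p \<le> ereal (Q h)" by (rule eventually_mono) auto
          then have "ereal p \<le> l" unfolding l_def by (rule Liminf_bounded)
          with z p show False by (metis ereal_less_eq(3) less_le_not_le order.strict_trans2 order_less_imp_le)
        qed
        moreover have "S (\<lambda>y. q \<le> y) x"
        proof (rule freq, rule notI)
          assume "\<forall>\<^sub>F h in at 0. \<not> q \<le> Q h"
          then have "\<forall>\<^sub>F h in at 0. ereal (Q h) \<le> ereal q" by (rule eventually_mono) auto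
          then have "L \<le> ereal q" unfolding L_def by (rule Limsup_bounded)
          moreover have "ereal q < ereal w" using q by simp
          ultimately show False using w by (meson leD less_le_trans order_less_imp_le order.strict_trans2)
        qed
        ultimately have "x \<in> E (p,q)" using x by (auto simp: E_def)
        then show False using n p q by blast
      qed
      ultimately have lL: "l = L" by simp
      have lim: "((\<lambda>h. ereal (Q h)) \<longlongrightarrow> l) (at 0)"
        by (intro Liminf_eq_Limsup) (use lL in \<open>auto simp: l_def L_def\<close>)
      have "ereal (-\<kappa>) \<le> l" unfolding l_def using bd by (intro Liminf_bounded) (auto elim!: eventually_mono)
      moreover have "L \<le> ereal \<kappa>" unfolding L_def using bd by (intro Limsup_bounded) (auto elim!: eventually_mono)
      ultimately obtain r where "l = ereal r" using lL by (cases l) auto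
      then have "(Q \<longlongrightarrow> r) (at 0)" using lim by simp
      then have "(H has_field_derivative r) (at x)" unfolding DERIV_def Q_def .
      then show False using x(2) by (auto simp: differentiable_def has_field_derivative_def)
    qed
  qed
  moreover have "negligible (Z \<union> \<Union>(E ` {(p,q). p \<in> \<rat> \<and> q \<in> \<rat> \<and> p < q}))"
  proof (intro negligible_Un Z negligible_countable_Union)
    have "{(p,q). p \<in> \<rat> \<and> q \<in> \<rat> \<and> p < q} \<subseteq> \<rat> \<times> (\<rat>::real set)" by auto
    moreover have "countable (\<rat> \<times> (\<rat>::real set))" by (intro countable_SIGMA countable_rat)
    ultimately have "countable {(p,q). p \<in> \<rat> \<and> q \<in> (\<rat>::real set) \<and> p < q}"
      by (rule countable_subset)
    then show "countable (E ` {(p,q). p \<in> \<rat> \<and> q \<in> \<rat> \<and> p < q})"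
      by (rule countable_image)
    show "negligible T" if "T \<in> E ` {(p,q). p \<in> \<rat> \<and> q \<in> \<rat> \<and> p < q}" for T
      using that E by auto
  qed
  ultimately show ?thesis by (rule negligible_subset[rotated])
qed

section \<open>The fundamental theorem of calculus for absolutely continuous functions\<close>

text \<open>
  A Henstock argument. At points outside \<open>N\<close> the gauge makes the Riemann sum close to the increment, as
  in the everywhere differentiable case. The tags in \<open>N\<close> are forced by the gauge into an open set of
  small measure, where absolute continuity controls the increments; the integrand is set to zero
  there.
\<close>

theorem ac_fundamental_theorem:
  fixes G :: "real \<Rightarrow> 'a::banach"
  assumes ac: "ac_on a b G" and ab: "a < b" and N: "negligible N"
    and der: "\<And>x. x \<in> {a<..<b} - N \<Longrightarrow> (G has_vector_derivative g x) (at x)"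
  shows "(g has_integral (G b - G a)) {a..b}"
proof -
  define M where "M = insert a (insert b N)"
  define f where "f = (\<lambda>x. if x \<in> M then 0 else g x)"
  have M: "negligible M" using N by (auto simp: M_def)
  have "(f has_integral (G b - G a)) {a..b}"
    unfolding has_integral_factor_content box_real[symmetric]
  proof (intro allI impI)
    fix e :: real assume e: "e > 0"
    \<comment> \<open>The endpoints, where no derivative is given, belong to \<open>M\<close>.\<close>
    have "\<forall>x. \<exists>d>0. x \<in> {a..b} - M \<longrightarrow>
         (\<forall>y. norm (y-x) < d \<longrightarrow> norm (G y - G x - (y-x) *\<^sub>R g x) \<le> e/2 * norm (y-x))"
    proof
      fix x
      show "\<exists>d>0. x \<in> {a..b} - M \<longrightarrow>
         (\<forall>y. norm (y-x) < d \<longrightarrow> norm (G y - G x - (y-x) *\<^sub>R g x) \<le> e/2 * norm (y-x))"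
      proof (cases "x \<in> {a..b} - M")
        case True
        then have "(G has_vector_derivative g x) (at x)" by (intro der) (auto simp: M_def)
        then show ?thesis
          using e unfolding has_vector_derivative_def has_derivative_within_alt
          by (elim conjE allE[of _ "e/2"]) auto
      qed (auto intro: exI[of _ 1])
    qed
    then obtain d where d: "\<And>x. 0 < d x"
      "\<And>x y. \<lbrakk>x \<in> {a..b} - M; norm (y-x) < d x\<rbrakk> \<Longrightarrow> norm (G y - G x - (y-x) *\<^sub>R g x) \<le> e/2 * norm (y-x)"
      by metis
    have eb: "e * (b - a) / 2 > 0" using e ab by simp
    obtain \<delta> where \<delta>: "\<delta> > 0" "\<forall>d. d division_of (\<Union>d) \<and> \<Union>d \<subseteq> {a..b} \<and> (\<Sum>K\<in>d. Sup K - Inf K) < \<delta>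
        \<longrightarrow> (\<Sum>K\<in>d. norm (G (Sup K) - G (Inf K))) < e * (b - a) / 2"
      using ac_onD[OF ac eb] by blast
    obtain U where U: "open U" "M \<subseteq> U" "U \<in> lmeasurable" "measure lebesgue U < \<delta>"
    proof -
      obtain T where T: "open T" "M \<subseteq> T" "(T - M) \<in> lmeasurable" "emeasure lebesgue (T - M) < ennreal \<delta>"
        using sets_lebesgue_outer_open[of M \<delta>] negligible_imp_measurable[OF M] \<delta>(1) by (auto intro: fmeasurableD)
      have TM: "T = M \<union> (T - M)" using T(2) by auto
      have Tm: "T \<in> lmeasurable" using T(3) negligible_imp_measurable[OF M] TM by (metis fmeasurable.Un)
      have "emeasure lebesgue T = emeasure lebesgue (T - M)"
        using M Tm by (simp add: emeasure_Diff_null_set negligible_iff_null_sets fmeasurableD)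
      then have "ennreal (measure lebesgue T) < ennreal \<delta>"
        using T(4) Tm by (simp add: emeasure_eq_measure2)
      then have "measure lebesgue T < \<delta>" using \<delta>(1) by (simp add: ennreal_less_iff)
      then show thesis using that[OF T(1,2) Tm] by blast
    qed
    define \<gamma> where "\<gamma> = (\<lambda>x. if x \<in> M then U else ball x (d x))"
    show "\<exists>d. gauge d \<and> (\<forall>p. p tagged_division_of (cbox a b) \<and> d fine p \<longrightarrow>
      norm ((\<Sum>(x, k)\<in>p. measure lborel k *\<^sub>R f x) - (G b - G a)) \<le> e * measure lborel (cbox a b))"
    proof (intro exI[of _ \<gamma>] conjI allI impI)
      show "gauge \<gamma>" using U d(1) by (auto simp: gauge_def \<gamma>_def)
      fix p assume p: "p tagged_division_of (cbox a b) \<and> \<gamma> fine p"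
      then have ptag: "p tagged_division_of {a..b}" and fine: "\<gamma> fine p" by auto
      have fin: "finite p" using p by auto
      have K: "\<exists>u v. K = {u..v} \<and> u \<le> v \<and> x \<in> {u..v} \<and> {u..v} \<subseteq> {a..b}" if "(x,K) \<in> p" for x K
        using tagged_division_ofD(2-4)[OF ptag that] by auto
      have ba: "b - a = (\<Sum>(x,K)\<in>p. Sup K - Inf K)" "G b - G a = (\<Sum>(x,K)\<in>p. G (Sup K) - G (Inf K))"
        using additive_tagged_division_1[OF less_imp_le[OF ab] ptag, where f= "\<lambda>x. x"]
          additive_tagged_division_1[OF less_imp_le[OF ab] ptag, where f= G] by auto
      define pM where "pM = {t \<in> p. fst t \<in> M}"
      define pD where "pD = {t \<in> p. fst t \<notin> M}"
      have split: "p = pM \<union> pD" "pM \<inter> pD = {}" "finite pM" "finite pD"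
        using fin by (auto simp: pM_def pD_def)
      define T where "T = (\<lambda>(x, K). measure lborel K *\<^sub>R f x - (G (Sup K) - G (Inf K)))"
      have "norm (sum T pD) \<le> (\<Sum>(x,K)\<in>pD. e/2 * (Sup K - Inf K))"
      proof (rule sum_norm_le, clarify)
        fix x K assume "(x,K) \<in> pD"
        then have xK: "(x,K) \<in> p" "x \<notin> M" by (auto simp: pD_def)
        obtain u v where uv: "K = {u..v}" "u \<le> v" "x \<in> {u..v}" "{u..v} \<subseteq> {a..b}" using K[OF xK(1)] by auto
        have "K \<subseteq> ball x (d x)" using fineD[OF fine xK(1)] xK(2) by (simp add: \<gamma>_def)
        moreover have "u \<in> K" "v \<in> K" using uv by auto
        ultimately have "u \<in> ball x (d x)" "v \<in> ball x (d x)" by blast+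
        then have uv': "norm (u - x) < d x" "norm (v - x) < d x" by (auto simp: dist_real_def)
        have x: "x \<in> {a..b} - M" using uv xK by auto
        have "T (x,K) = (G u - G x - (u-x) *\<^sub>R g x) - (G v - G x - (v-x) *\<^sub>R g x)"
          using uv xK by (simp add: T_def f_def algebra_simps)
        also have "norm \<dots> \<le> e/2 * norm (u-x) + e/2 * norm (v-x)"
          by (rule order_trans[OF norm_triangle_ineq4 add_mono[OF d(2)[OF x uv'(1)] d(2)[OF x uv'(2)]]])
        also have "\<dots> = e/2 * (v - u)" using uv by (simp add: field_simps)
        finally show "norm (T (x,K)) \<le> e/2 * (Sup K - Inf K)" using uv by simp
      qed
      also have "\<dots> \<le> (\<Sum>(x,K)\<in>p. e/2 * (Sup K - Inf K))"
        using fin e K by (intro sum_mono2) (force simp: pD_def)+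
      also have "\<dots> = e/2 * (b - a)" unfolding ba by (simp add: sum_distrib_left split_def)
      finally have D: "norm (sum T pD) \<le> e/2 * (b - a)" .
      have pMp: "pM tagged_partial_division_of {a..b}"
        using ptag tagged_partial_division_subset[of p "{a..b}" pM]
        by (auto simp: tagged_division_of_def pM_def)
      define h where "h = (\<lambda>K. if K = {} then 0 else norm (G (Sup K) - G (Inf K)))"
      have "norm (sum T pM) \<le> (\<Sum>(x,K)\<in>pM. h K)"
      proof (rule sum_norm_le, clarify)
        fix x K assume "(x,K) \<in> pM"
        then have xK: "(x,K) \<in> p" "x \<in> M" by (auto simp: pM_def)
        then show "norm (T (x,K)) \<le> h K" using K[OF xK(1)] by (auto simp: T_def h_def f_def norm_minus_commute)
      qed
      also have "\<dots> = sum h (snd ` pM)"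
        by (rule sum.over_tagged_division_lemma[OF tagged_partial_division_of_Union_self[OF pMp]])
           (auto simp: h_def not_less dest: order_antisym)
      also have "\<dots> = (\<Sum>K\<in>snd ` pM. norm (G (Sup K) - G (Inf K)))"
        using K by (intro sum.cong) (force simp: h_def pM_def)+
      also have "\<dots> < e * (b - a) / 2"
      proof (rule \<delta>(2)[rule_format], intro conjI)
        show dv: "(snd ` pM) division_of \<Union> (snd ` pM)" by (rule partial_division_of_tagged_division[OF pMp])
        show "\<Union> (snd ` pM) \<subseteq> {a..b}" using K by (fastforce simp: pM_def)
        have "\<Union> (snd ` pM) \<subseteq> U"
        proof
          fix y assume "y \<in> \<Union> (snd ` pM)"
          then obtain x K where "(x,K) \<in> p" "x \<in> M" "y \<in> K" by (auto simp: pM_def)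
          then show "y \<in> U" using fineD[OF fine \<open>(x,K) \<in> p\<close>] by (auto simp: \<gamma>_def)
        qed
        then have "measure lebesgue (\<Union> (snd ` pM)) \<le> measure lebesgue U"
          using U measure_division(1)[OF dv] by (intro measure_mono_fmeasurable) (auto intro: fmeasurableD)
        then show "(\<Sum>K\<in>snd ` pM. Sup K - Inf K) < \<delta>" using U measure_division(2)[OF dv] by linarith
      qed
      finally have Mb: "norm (sum T pM) < e * (b - a) / 2" .
      have "(\<Sum>(x, k)\<in>p. measure lborel k *\<^sub>R f x) - (G b - G a) = sum T p"
        unfolding ba(2) T_def by (simp add: sum_subtractf split_def)
      also have "\<dots> = sum T pM + sum T pD" using split by (metis sum.union_disjoint)
      finally have "norm ((\<Sum>(x, k)\<in>p. measure lborel k *\<^sub>R f x) - (G b - G a)) \<le> norm (sum T pM) + norm (sum T pD)"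
        by (simp add: norm_triangle_ineq)
      also have "\<dots> \<le> e * (b - a)" using D Mb by (simp add: field_simps)
      finally show "norm ((\<Sum>(x, k)\<in>p. measure lborel k *\<^sub>R f x) - (G b - G a)) \<le> e * measure lborel (cbox a b)"
        using ab by simp
    qed
  qed
  then show ?thesis
    by (rule has_integral_spike[OF M, rotated]) (auto simp: f_def)
qed

lemma ac_on_subset:
  assumes "ac_on a b G" "{u..v} \<subseteq> {a..b}"
  shows "ac_on u v G"
  unfolding ac_on_def
proof (intro allI impI)
  fix \<epsilon> :: real assume "\<epsilon> > 0"
  then obtain \<delta> where \<delta>: "\<delta> > 0" "\<forall>d. d division_of (\<Union>d) \<and> \<Union>d \<subseteq> {a..b} \<and> (\<Sum>K\<in>d. Sup K - Inf K) < \<delta>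
        \<longrightarrow> (\<Sum>K\<in>d. norm (G (Sup K) - G (Inf K))) < \<epsilon>"
    using ac_onD[OF assms(1), of \<epsilon>] by blast
  then show "\<exists>\<delta>>0. \<forall>d. d division_of (\<Union>d) \<and> \<Union>d \<subseteq> {u..v} \<and> (\<Sum>K\<in>d. Sup K - Inf K) < \<delta>
        \<longrightarrow> (\<Sum>K\<in>d. norm (G (Sup K) - G (Inf K))) < \<epsilon>"
    using assms(2) by (meson order_trans)
qed

text \<open>
  On intervals shorter than the \<open>\<delta>\<close> that belongs to \<open>\<epsilon> = 1\<close> the indefinite integral has variation at
  most \<open>1\<close>, hence the integral converges absolutely; finitely many such intervals make up \<open>{a..b}\<close>.
\<close>

theorem ac_derivative_absolutely_integrable:
  fixes G :: "real \<Rightarrow> 'a::euclidean_space"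
  assumes ac: "ac_on a b G" and ab: "a < b" and N: "negligible N"
    and der: "\<And>x. x \<in> {a<..<b} - N \<Longrightarrow> (G has_vector_derivative g x) (at x)"
  shows "g absolutely_integrable_on {a..b}"
proof -
  have ftc: "(g has_integral (G v - G u)) {u..v}" if "a \<le> u" "u \<le> v" "v \<le> b" for u v
  proof (cases "u = v")
    case True
    then show ?thesis using has_integral_refl(2)[of g u] by simp
  next
    case False
    show ?thesis
    proof (rule ac_fundamental_theorem[OF _ _ N])
      show "ac_on u v G" using that by (intro ac_on_subset[OF ac]) auto
      show "u < v" using False that by simp
      show "(G has_vector_derivative g x) (at x)" if "x \<in> {u<..<v} - N" for x
        using that \<open>a \<le> u\<close> \<open>v \<le> b\<close> by (intro der) auto
    qed
  qed
  obtain \<delta> where \<delta>: "\<delta> > 0" "\<forall>d. d division_of (\<Union>d) \<and> \<Union>d \<subseteq> {a..b} \<and> (\<Sum>K\<in>d. Sup K - Inf K) < \<delta>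
        \<longrightarrow> (\<Sum>K\<in>d. norm (G (Sup K) - G (Inf K))) < 1"
    using ac_onD[OF ac zero_less_one] by blast
  have small: "g absolutely_integrable_on {u..v}" if uv: "a \<le> u" "u \<le> v" "v \<le> b" "v - u < \<delta>" for u v
    unfolding box_real[symmetric]
  proof (rule bounded_variation_absolutely_integrable_interval[where B = 1])
    show "g integrable_on cbox u v" using ftc[OF uv(1-3)] by (auto simp: has_integral_integrable)
    fix d assume d: "d division_of cbox u v"
    have K: "\<exists>c e. K = {c..e} \<and> c \<le> e \<and> u \<le> c \<and> e \<le> v" if "K \<in> d" for K
    proof -
      obtain c e where ce: "K = cbox c e" using division_ofD(4)[OF d \<open>K \<in> d\<close>] by blast
      then have "c \<le> e" using division_ofD(3)[OF d that] by auto
      moreover have "{c..e} \<subseteq> {u..v}" using division_ofD(2)[OF d that] ce by auto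
      ultimately show ?thesis using ce by (intro exI[of _ c] exI[of _ e]) auto
    qed
    have "(\<Sum>K\<in>d. norm (integral K g)) = (\<Sum>K\<in>d. norm (G (Sup K) - G (Inf K)))"
    proof (intro sum.cong refl)
      fix K assume "K \<in> d"
      then obtain c e where "K = {c..e}" "c \<le> e" "u \<le> c" "e \<le> v" using K by blast
      then show "norm (integral K g) = norm (G (Sup K) - G (Inf K))"
        using ftc[of c e] uv by (auto simp: integral_unique)
    qed
    also have "\<dots> < 1"
    proof (rule \<delta>(2)[rule_format], intro conjI)
      show "d division_of \<Union>d" using d by blast
      show "\<Union>d \<subseteq> {a..b}" using division_ofD(6)[OF d] uv by auto
      show "(\<Sum>K\<in>d. Sup K - Inf K) < \<delta>"
        using sum_increments_division[of d u v "\<lambda>x. x"] d uv by simp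
    qed
    finally show "(\<Sum>K\<in>d. norm (integral K g)) \<le> 1" by simp
  qed
  have "g absolutely_integrable_on {a..min b (a + real m * (\<delta>/2))}" for m
  proof (induction m)
    case 0
    then show ?case using small[of a a] ab \<delta> by simp
  next
    case (Suc m)
    let ?u = "min b (a + real m * (\<delta>/2))" and ?v = "min b (a + real (Suc m) * (\<delta>/2))"
    have v: "?v = min b (a + real m * (\<delta>/2) + \<delta>/2)" by (simp add: algebra_simps add_divide_distrib)
    have "0 \<le> real m * (\<delta>/2)" using \<delta>(1) by simp
    then have le: "a \<le> ?u" "?u \<le> ?v" "?v \<le> b" "?v - ?u < \<delta>"
      unfolding v using \<delta>(1) ab by (auto simp: min_def)
    have "g absolutely_integrable_on ({a..?u} \<union> {?u..?v})"
      using small[OF le] Suc by (intro set_integrable_Un) auto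
    also have "{a..?u} \<union> {?u..?v} = {a..?v}" using le(1,2) by (rule ivl_disj_un_two_touch(4))
    finally show ?case .
  qed
  moreover obtain m where "(b - a) / (\<delta>/2) < real m" using reals_Archimedean2 by blast
  then have "min b (a + real m * (\<delta>/2)) = b" using \<delta>(1) by (simp add: field_simps)
  ultimately show ?thesis by metis
qed

theorem ac_complex_differentiable_ae:
  fixes G :: "real \<Rightarrow> complex"
  assumes ac: "ac_on a b G"
  shows "negligible {x \<in> {a<..<b}. \<not> G differentiable (at x)}"
proof -
  have part: "ac_on a b (\<lambda>x. h (G x))" if h: "\<And>z w. \<bar>h z - h w\<bar> \<le> norm (z - w)" for h :: "complex \<Rightarrow> real"
    unfolding ac_on_def
  proof (intro allI impI)
    fix \<epsilon> :: real assume "\<epsilon> > 0"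
    then obtain \<delta> where \<delta>: "\<delta> > 0" "\<forall>d. d division_of (\<Union>d) \<and> \<Union>d \<subseteq> {a..b} \<and> (\<Sum>K\<in>d. Sup K - Inf K) < \<delta>
          \<longrightarrow> (\<Sum>K\<in>d. norm (G (Sup K) - G (Inf K))) < \<epsilon>"
      using ac_onD[OF ac, of \<epsilon>] by blast
    have "(\<Sum>K\<in>d. norm (h (G (Sup K)) - h (G (Inf K)))) \<le> (\<Sum>K\<in>d. norm (G (Sup K) - G (Inf K)))" for d :: "real set set"
      using h by (intro sum_mono) simp
    with \<delta> show "\<exists>\<delta>>0. \<forall>d. d division_of (\<Union>d) \<and> \<Union>d \<subseteq> {a..b} \<and> (\<Sum>K\<in>d. Sup K - Inf K) < \<delta>
          \<longrightarrow> (\<Sum>K\<in>d. norm (h (G (Sup K)) - h (G (Inf K)))) < \<epsilon>"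
      by (meson le_less_trans)
  qed
  have "negligible ({x \<in> {a<..<b}. \<not> (\<lambda>x. Re (G x)) differentiable (at x)} \<union> {x \<in> {a<..<b}. \<not> (\<lambda>x. Im (G x)) differentiable (at x)})"
    by (intro negligible_Un ac_real_differentiable_ae part)
       (metis abs_Re_le_cmod minus_complex.simps(1), metis abs_Im_le_cmod minus_complex.simps(2))
  moreover have "G differentiable (at x)"
    if "(\<lambda>x. Re (G x)) differentiable (at x)" "(\<lambda>x. Im (G x)) differentiable (at x)" for x
    using that by (subst differentiable_componentwise_within) (auto simp: Basis_complex_def)
  ultimately show ?thesis by (elim negligible_subset) blast
qed

theorem ac_complex_ftc:
  fixes G :: "real \<Rightarrow> complex" and a b :: real
  defines "g \<equiv> \<lambda>x. vector_derivative G (at x within {a..b})"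
  assumes ac: "ac_on a b G" and ab: "a < b"
  shows "g absolutely_integrable_on {a..b}"
    and "\<And>x. x \<in> {a..b} \<Longrightarrow> integral {a..x} g = G x - G a"
proof -
  define N where "N = {x \<in> {a<..<b}. \<not> G differentiable (at x)}"
  have N: "negligible N" unfolding N_def by (rule ac_complex_differentiable_ae[OF ac])
  have der: "(G has_vector_derivative g x) (at x)" if "x \<in> {a<..<b} - N" for x
  proof -
    have x: "a < x" "x < b" and d: "G differentiable (at x)" using that by (auto simp: N_def)
    have "at x within {a..b} = at x" using x by (simp add: at_within_Icc_at)
    then show ?thesis using d by (simp add: g_def vector_derivative_works)
  qed
  show "g absolutely_integrable_on {a..b}"
    by (rule ac_derivative_absolutely_integrable[OF ac ab N der])
  fix x assume x: "x \<in> {a..b}"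
  show "integral {a..x} g = G x - G a"
  proof (cases "x = a")
    case False
    have "(g has_integral (G x - G a)) {a..x}"
    proof (rule ac_fundamental_theorem[OF _ _ N])
      show "ac_on a x G" using x by (intro ac_on_subset[OF ac]) auto
      show "a < x" using False x by simp
      show "(G has_vector_derivative g y) (at y)" if "y \<in> {a<..<x} - N" for y
        using that x by (intro der) auto
    qed
    then show ?thesis by (rule integral_unique)
  qed simp
qed

section \<open>Lebesgue integrals on the line\<close>

lemma sigma_finite_lebesgue: "sigma_finite_measure (lebesgue :: 'a::euclidean_space measure)"
proof
  obtain A :: "'a set set" where A: "countable A" "A \<subseteq> sets lborel" "\<Union>A = space lborel" "\<forall>a\<in>A. emeasure lborel a \<noteq> \<infinity>"
    using lborel.sigma_finite_countable by blast
  show "\<exists>A::'a set set. countable A \<and> A \<subseteq> sets lebesgue \<and> \<Union>A = space lebesgue \<and> (\<forall>a\<in>A. emeasure lebesgue a \<noteq> \<infinity>)"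
  proof (intro exI[of _ A] conjI ballI)
    show "A \<subseteq> sets lebesgue" using A(2) by (auto intro: sets_completionI_sets)
    show "emeasure lebesgue s \<noteq> \<infinity>" if "s \<in> A" for s
      using A(2,4) that by auto
  qed (use A in auto)
qed

interpretation lebesgue: sigma_finite_measure lebesgue by (rule sigma_finite_lebesgue)
interpretation lebesgue2: pair_sigma_finite lebesgue lebesgue ..

text \<open>
  Lebesgue measure is complete, so functions that agree almost everywhere are either both measurable
  or both not, and in the latter case both integrals have the default value \<open>0\<close>.
\<close>

lemma set_lebesgue_integral_lebesgue_cong_AE:
  fixes f g :: "real \<Rightarrow> complex"
  assumes "AE x in lebesgue. x \<in> S \<longrightarrow> f x = g x"
  shows "set_integrable lebesgue S f \<longleftrightarrow> set_integrable lebesgue S g"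
    and "(LINT x:S|lebesgue. f x) = (LINT x:S|lebesgue. g x)"
proof -
  let ?f = "\<lambda>x. indicator S x *\<^sub>R f x" and ?g = "\<lambda>x. indicator S x *\<^sub>R g x"
  have ae: "AE x in lebesgue. ?f x = ?g x" using assms by eventually_elim (auto simp: indicator_def)
  then have ae': "AE x in lebesgue. ?g x = ?f x" by eventually_elim (erule sym)
  have m: "?f \<in> borel_measurable lebesgue \<longleftrightarrow> ?g \<in> borel_measurable lebesgue"
    using borel_measurable_AE[OF _ ae] borel_measurable_AE[OF _ ae'] by blast
  show "set_integrable lebesgue S f \<longleftrightarrow> set_integrable lebesgue S g"
    unfolding set_integrable_def
    using m integrable_cong_AE[of ?f lebesgue ?g] ae borel_measurable_integrable by blast
  show "(LINT x:S|lebesgue. f x) = (LINT x:S|lebesgue. g x)"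
    unfolding set_lebesgue_integral_def
  proof (cases "?f \<in> borel_measurable lebesgue")
    case True
    then show "integral\<^sup>L lebesgue ?f = integral\<^sup>L lebesgue ?g" using m ae by (intro integral_cong_AE) auto
  next
    case False
    then show "integral\<^sup>L lebesgue ?f = integral\<^sup>L lebesgue ?g"
      using m not_integrable_integral_eq borel_measurable_integrable by metis
  qed
qed

lemma AE_lebesgue_neq: "AE x in lebesgue. x \<noteq> (c::real)"
  using AE_not_in[of "{c}" lebesgue] by (simp add: negligible_iff_null_sets[symmetric])

text \<open>
  By Henstock's lemma, Riemann sums of \<open>\<phi>\<close> on fine divisions differ from the integrals over the pieces
  by little even in the sum of the norms. Here these integrals vanish, so the Riemann sums of \<open>norm \<phi>\<close> are
  small, and so is its integral.
\<close>

lemma zero_integrals_imp_zero_AE: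
  fixes \<phi> :: "real \<Rightarrow> complex"
  assumes int: "set_integrable lebesgue {a..b} \<phi>"
    and zero: "\<And>x. x \<in> {a..b} \<Longrightarrow> (LINT t:{a..x}|lebesgue. \<phi> t) = 0"
  shows "AE x in lebesgue. x \<in> {a..b} \<longrightarrow> \<phi> x = 0"
proof (cases "a \<le> b")
  case ab: True
  have I: "\<phi> integrable_on {a..b}" and In: "(\<lambda>x. norm (\<phi> x)) integrable_on {a..b}"
    using int by (auto simp: absolutely_integrable_on_def)
  have K0: "integral {u..v} \<phi> = 0" if "a \<le> u" "u \<le> v" "v \<le> b" for u v
  proof -
    have z: "integral {a..x} \<phi> = 0" if "a \<le> x" "x \<le> b" for x
      using zero[of x] that set_lebesgue_integral_eq_integral(2)[OF set_integrable_subset[OF int, of "{a..x}"]] by auto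
    have "integral {a..u} \<phi> + integral {u..v} \<phi> = integral {a..v} \<phi>"
      using that I by (intro Henstock_Kurzweil_Integration.integral_combine) (auto intro: integrable_on_subinterval)
    then show ?thesis using z[of u] z[of v] that by simp
  qed
  have "integral {a..b} (\<lambda>x. norm (\<phi> x)) \<le> 0 + e" if e: "e > 0" for e
  proof -
    obtain \<gamma> where \<gamma>: "gauge \<gamma>" "\<And>p. \<lbrakk>p tagged_partial_division_of (cbox a b); \<gamma> fine p\<rbrakk> \<Longrightarrow>
             (\<Sum>(x,k)\<in>p. norm (measure lborel k *\<^sub>R \<phi> x - integral k \<phi>)) < e/2"
      using Henstock_lemma[of \<phi> a b "e/2"] I e by auto
    have e2: "e/2 > 0" using e by simp
    obtain \<gamma>' where \<gamma>': "gauge \<gamma>'" "\<forall>p. p tagged_division_of {a..b} \<and> \<gamma>' fine p \<longrightarrow>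
             norm ((\<Sum>(x,k)\<in>p. measure lborel k *\<^sub>R norm (\<phi> x)) - integral {a..b} (\<lambda>x. norm (\<phi> x))) < e/2"
      using integrable_integral[OF In, unfolded has_integral_real, rule_format, OF e2] by blast
    obtain p where p: "p tagged_division_of (cbox a b)" "(\<lambda>x. \<gamma> x \<inter> \<gamma>' x) fine p"
      using fine_division_exists[OF gauge_Int[OF \<gamma>(1) \<gamma>'(1)]] by blast
    have pf: "\<gamma> fine p" "\<gamma>' fine p" using p(2) by (auto simp: fine_def)
    have "(\<Sum>(x,k)\<in>p. measure lborel k *\<^sub>R norm (\<phi> x)) = (\<Sum>(x,k)\<in>p. norm (measure lborel k *\<^sub>R \<phi> x - integral k \<phi>))"
    proof (intro sum.cong refl, clarify)
      fix x k assume xk: "(x,k) \<in> p"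
      obtain u v where uv: "k = cbox u v" using tagged_division_ofD(4)[OF p(1) xk] by blast
      moreover have "x \<in> k" "k \<subseteq> cbox a b" using tagged_division_ofD(2,3)[OF p(1) xk] by auto
      ultimately have "u \<le> v" "a \<le> u" "v \<le> b" by auto
      then have "integral k \<phi> = 0" using K0[of u v] uv by simp
      then show "measure lborel k *\<^sub>R norm (\<phi> x) = norm (measure lborel k *\<^sub>R \<phi> x - integral k \<phi>)" by simp
    qed
    also have "\<dots> < e/2" using p(1) pf by (intro \<gamma>(2)) (auto simp: tagged_division_of_def)
    finally have "(\<Sum>(x,k)\<in>p. measure lborel k *\<^sub>R norm (\<phi> x)) < e/2" .
    moreover have "\<bar>(\<Sum>(x,k)\<in>p. measure lborel k *\<^sub>R norm (\<phi> x)) - integral {a..b} (\<lambda>x. norm (\<phi> x))\<bar> < e/2"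
      using \<gamma>'(2)[rule_format, of p] p(1) pf(2) by simp
    ultimately show ?thesis by linarith
  qed
  then have "integral {a..b} (\<lambda>x. norm (\<phi> x)) \<le> 0" by (rule field_le_epsilon)
  moreover have "set_integrable lebesgue {a..b} (\<lambda>x. norm (\<phi> x))" using int by (rule set_integrable_norm)
  ultimately have le: "(LINT x:{a..b}|lebesgue. norm (\<phi> x)) \<le> 0"
    by (simp add: set_lebesgue_integral_eq_integral(2))
  have "integrable lebesgue (\<lambda>x. norm (indicator {a..b} x *\<^sub>R \<phi> x))"
    using int unfolding set_integrable_def by (rule integrable_norm)
  moreover have "(LINT x|lebesgue. norm (indicator {a..b} x *\<^sub>R \<phi> x)) = 0"
  proof (rule antisym)
    show "(LINT x|lebesgue. norm (indicator {a..b} x *\<^sub>R \<phi> x)) \<le> 0" using le by (simp add: set_lebesgue_integral_def)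
  qed simp
  ultimately have "AE x in lebesgue. norm (indicator {a..b} x *\<^sub>R \<phi> x) = 0"
    by (subst (asm) integral_nonneg_eq_0_iff_AE) auto
  then show ?thesis by eventually_elim auto
qed auto

lemma set_integral_point: "(LINT t:{c..c::real}|lebesgue. f t) = (0::complex)"
proof -
  have "AE t in lebesgue. t \<in> {c..c} \<longrightarrow> f t = 0"
    using AE_lebesgue_neq[of c] by eventually_elim auto
  from set_lebesgue_integral_lebesgue_cong_AE(2)[OF this] show ?thesis
    by (simp add: set_lebesgue_integral_def)
qed

section \<open>Fractional integration after a change of time\<close>

text \<open>
  Fractional integrals in a new time scale \<open>T\<close> with speed \<open>w\<close> are kept on \<open>{a..b}\<close> instead of being
  transported to the range of \<open>T\<close>. The substitution is then carried out only once, in the Beta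
  integral.
\<close>

locale change_of_time =
  fixes a b :: real and T w :: "real \<Rightarrow> real"
  assumes ab: "a < b"
    and der: "\<And>x. x \<in> {a..b} \<Longrightarrow> (T has_field_derivative w x) (at x within {a..b})"
    and w_cont: "continuous_on {a..b} w"
    and w_pos: "\<And>x. x \<in> {a..b} \<Longrightarrow> 0 < w x"
begin

lemma T_cont: "continuous_on {a..b} T"
  using der by (meson DERIV_continuous continuous_on_eq_continuous_within)

lemma T_less: "T x < T y" if "a \<le> x" "x < y" "y \<le> b" for x y
proof (rule DERIV_pos_imp_increasing_open[OF \<open>x < y\<close>])
  fix z assume "x < z" "z < y"
  then have z: "z \<in> {a..b}" "z \<in> {a<..<b}" using that by auto
  then have "at z within {a..b} = at z" by (simp add: at_within_Icc_at)
  then show "\<exists>y. (T has_real_derivative y) (at z) \<and> 0 < y"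
    using der[OF z(1)] w_pos[OF z(1)] by auto
next
  show "continuous_on {x..y} T" using that by (intro continuous_on_subset[OF T_cont]) auto
qed

lemma T_le: "a \<le> x \<Longrightarrow> x \<le> y \<Longrightarrow> y \<le> b \<Longrightarrow> T x \<le> T y"
  using T_less[of x y] by (cases "x = y") auto

text \<open>
  The substitution \<open>y = (T t - T r) / (T x - T r)\<close> leads to Euler's Beta integral.
\<close>

lemma Beta_kernel:
  assumes "\<alpha> > 0" "\<beta> > 0" and rx: "a \<le> r" "r \<le> x" "x \<le> b"
  defines "k \<equiv> \<lambda>t. (T x - T t) powr (\<alpha> - 1) * (T t - T r) powr (\<beta> - 1) * w t"
  shows "set_integrable lebesgue {r..x} k"
    and "(LINT t:{r..x}|lebesgue. k t) = Beta \<alpha> \<beta> * (T x - T r) powr (\<alpha> + \<beta> - 1)"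
proof -
  have "set_integrable lebesgue {r..x} k \<and> (LINT t:{r..x}|lebesgue. k t) = Beta \<alpha> \<beta> * (T x - T r) powr (\<alpha> + \<beta> - 1)"
  proof (cases "r = x")
    case True
    have n: "{x} \<in> null_sets lebesgue" by (simp add: negligible_iff_null_sets[symmetric])
    have "AE t in lebesgue. indicator {x} t *\<^sub>R k t = 0"
      using AE_not_in[OF n] by eventually_elim auto
    then have "(LINT t:{x}|lebesgue. k t) = 0"
      unfolding set_lebesgue_integral_def by (rule integral_eq_zero_AE)
    moreover have "k absolutely_integrable_on {x}"
      by (rule absolutely_integrable_negligible) simp
    ultimately show ?thesis using True by simp
  next
    case False
    define D where "D = T x - T r"
    have D: "D > 0" using T_less[of r x] rx False by (simp add: D_def)
    define g where "g = (\<lambda>t. (T t - T r) / D)"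
    have gder: "(g has_field_derivative w t / D) (at t within {r..x})" if "t \<in> {r..x}" for t
    proof -
      have "(T has_field_derivative w t) (at t within {r..x})"
        using that rx by (intro DERIV_subset[OF der]) auto
      then show ?thesis unfolding g_def using D by (auto intro!: derivative_eq_intros)
    qed
    have ginj: "inj_on g {r..x}"
    proof (rule inj_onI)
      fix s t assume *: "s \<in> {r..x}" "t \<in> {r..x}" "g s = g t"
      then have "T s = T t" using D by (simp add: g_def)
      with * rx T_less[of s t] T_less[of t s] show "s = t"
        by (cases s t rule: linorder_cases) auto
    qed
    have gim: "g ` {r..x} = {0..1}"
    proof
      show "g ` {r..x} \<subseteq> {0..1}"
        using T_le rx D by (auto simp: g_def D_def divide_le_eq)
      have "continuous_on {r..x} g"
        unfolding g_def using D rx by (intro continuous_intros continuous_on_subset[OF T_cont]) auto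
      then have "connected (g ` {r..x})" by (intro connected_continuous_image) auto
      moreover have "0 \<in> g ` {r..x}" by (rule image_eqI[of _ _ r]) (use rx in \<open>auto simp: g_def\<close>)
      moreover have "1 \<in> g ` {r..x}" by (rule image_eqI[of _ _ x]) (use rx D in \<open>auto simp: g_def D_def\<close>)
      ultimately show "{0..1} \<subseteq> g ` {r..x}" by (rule connected_contains_Icc)
    qed
    define f where "f = (\<lambda>y::real. y powr (\<beta> - 1) * (1 - y) powr (\<alpha> - 1))"
    have fi: "(f has_integral Beta \<beta> \<alpha>) {0..1}" unfolding f_def using assms by (intro has_integral_Beta_real) auto
    then have "f absolutely_integrable_on {0..1}"
      by (intro nonnegative_absolutely_integrable_1) (auto simp: f_def has_integral_integrable)
    then have "(\<lambda>t. \<bar>w t / D\<bar> * f (g t)) absolutely_integrable_on {r..x} \<and> integral {r..x} (\<lambda>t. \<bar>w t / D\<bar> * f (g t)) = Beta \<beta> \<alpha>"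
      using fi by (subst has_absolute_integral_change_of_variables_1'[OF _ gder ginj]) (auto simp: gim integral_unique)
    note * = this
    have i1: "(\<lambda>t. D powr (\<alpha>+\<beta>-1) * (\<bar>w t / D\<bar> * f (g t))) absolutely_integrable_on {r..x}"
      and i2: "integral {r..x} (\<lambda>t. D powr (\<alpha>+\<beta>-1) * (\<bar>w t / D\<bar> * f (g t))) = D powr (\<alpha>+\<beta>-1) * Beta \<alpha> \<beta>"
      using * unfolding integral_mult_right by (auto simp only: Beta_commute intro!: set_integrable_mult_right)
    have eq: "D powr (\<alpha>+\<beta>-1) * (\<bar>w t / D\<bar> * f (g t)) = k t" if t: "t \<in> {r..x}" for t
    proof -
      have "0 \<le> T t - T r" "0 \<le> T x - T t" using T_le t rx by auto
      moreover have "1 - g t = (T x - T t) / D" using D by (simp add: g_def D_def field_simps)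
      ultimately have "f (g t) = (T t - T r) powr (\<beta>-1) / D powr (\<beta> - 1) * ((T x - T t) powr (\<alpha> - 1) / D powr (\<alpha> - 1))"
        using D by (simp add: f_def g_def powr_divide)
      moreover have "D powr (\<alpha>+\<beta>-1) = D * D powr (\<beta> - 1) * D powr (\<alpha> - 1)"
      proof -
        have "D powr (\<alpha>+\<beta>-1) = D powr \<beta> * D powr (\<alpha> - 1)"
          by (simp add: powr_add[symmetric] algebra_simps)
        also have "D powr \<beta> = D * D powr (\<beta> - 1)" using powr_mult_base[of D "\<beta> - 1"] D by simp
        finally show ?thesis .
      qed
      moreover have "w t > 0" using w_pos t rx by auto
      ultimately show ?thesis using D by (simp add: k_def)
    qed
    have "set_integrable lebesgue {r..x} (\<lambda>t. D powr (\<alpha>+\<beta>-1) * (\<bar>w t / D\<bar> * f (g t))) = set_integrable lebesgue {r..x} k"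
      by (rule set_integrable_cong[OF refl refl eq])
    moreover have "integral {r..x} (\<lambda>t. D powr (\<alpha>+\<beta>-1) * (\<bar>w t / D\<bar> * f (g t))) = integral {r..x} k"
      by (rule integral_cong[OF eq])
    ultimately have "k absolutely_integrable_on {r..x}" "integral {r..x} k = D powr (\<alpha>+\<beta>-1) * Beta \<alpha> \<beta>"
      using i1 i2 by argo+
    then show ?thesis by (simp add: D_def set_lebesgue_integral_eq_integral mult.commute)
  qed
  then show "set_integrable lebesgue {r..x} k"
    and "(LINT t:{r..x}|lebesgue. k t) = Beta \<alpha> \<beta> * (T x - T r) powr (\<alpha> + \<beta> - 1)" by auto
qed

text \<open>
  The Riemann-Liouville integral of order \<open>\<beta>\<close> in the time scale \<open>T\<close>. The factor \<open>w\<close> that belongs to the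
  substitution is left to the integrand: Hadamard integrals bring it along, and an arbitrary
  integrable \<open>\<phi>\<close> is allowed.
\<close>

definition frac_int :: "real \<Rightarrow> (real \<Rightarrow> complex) \<Rightarrow> real \<Rightarrow> complex" where
  "frac_int \<beta> \<phi> x = of_real (1 / Gamma \<beta>) * (LINT t:{a..x}|lebesgue. of_real ((T x - T t) powr (\<beta> - 1)) * \<phi> t)"

text \<open>
  Exchange the order of integration; the inner integral is \<open>Beta_kernel\<close>. The hypothesis \<open>\<alpha> + \<beta> \<ge> 1\<close>
  makes the resulting kernel \<open>(T x - T r) powr (\<alpha> + \<beta> - 1)\<close> bounded, so that Fubini's theorem applies at
  every \<open>x\<close> and not only at almost every \<open>x\<close>.
\<close>

lemma frac_int_semigroup:
  assumes \<alpha>: "\<alpha> > 0" and \<beta>: "\<beta> > 0" and \<alpha>\<beta>: "\<alpha> + \<beta> \<ge> 1"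
    and \<phi>: "set_integrable lebesgue {a..b} \<phi>" and x: "x \<in> {a..b}"
  shows "set_integrable lebesgue {a..x} (\<lambda>t. of_real ((T x - T t) powr (\<alpha> - 1)) * (of_real (w t) * frac_int \<beta> \<phi> t))"
    and "frac_int \<alpha> (\<lambda>t. of_real (w t) * frac_int \<beta> \<phi> t) x = frac_int (\<alpha> + \<beta>) \<phi> x"
proof -
  \<comment> \<open>Nothing is known about \<open>T\<close>, \<open>w\<close> and \<open>\<phi>\<close> outside \<open>{a..b}\<close>, so they are cut off to become measurable.\<close>
  define T' where "T' = (\<lambda>t. indicator {a..b} t *\<^sub>R T t)"
  define w' where "w' = (\<lambda>t. indicator {a..b} t *\<^sub>R w t)"
  define \<phi>' where "\<phi>' = (\<lambda>t. indicator {a..b} t *\<^sub>R \<phi> t)"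
  have "T' \<in> borel_measurable borel" "w' \<in> borel_measurable borel"
    unfolding T'_def w'_def by (intro borel_measurable_continuous_on_indicator T_cont w_cont; simp)+
  then have [measurable]: "T' \<in> borel_measurable lebesgue" "w' \<in> borel_measurable lebesgue"
    by (auto intro: measurable_completion)
  have \<phi>'_int: "integrable lebesgue \<phi>'" using \<phi> by (simp add: set_integrable_def \<phi>'_def)
  then have [measurable]: "\<phi>' \<in> borel_measurable lebesgue" by auto
  have [measurable]: "(\<lambda>x::real. x) \<in> borel_measurable lebesgue" by (auto intro: measurable_completion)
  define k where "k = (\<lambda>r t. if a \<le> r \<and> r \<le> t \<and> t \<le> x then (T x - T' t) powr (\<alpha> - 1) * (T' t - T' r) powr (\<beta> - 1) * w' t else 0)"
  define F where "F = (\<lambda>(r,t). of_real (k r t) * \<phi>' r)"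
  have F_meas[measurable]: "F \<in> borel_measurable (lebesgue \<Otimes>\<^sub>M lebesgue)"
    unfolding F_def k_def by measurable
  have k_nn: "k r t \<ge> 0" for r t
    using w_pos[of t] x by (auto simp: k_def w'_def intro!: mult_nonneg_nonneg)
  have k_ind: "k r t = indicator {r..x} t *\<^sub>R ((T x - T t) powr (\<alpha> - 1) * (T t - T r) powr (\<beta> - 1) * w t)"
    if "a \<le> r" for r t using x that by (auto simp: k_def T'_def w'_def indicator_def)
  have k_int: "integrable lebesgue (k r)" and k_val: "(LINT t|lebesgue. k r t) = indicator {a..x} r * (Beta \<alpha> \<beta> * (T x - T r) powr (\<alpha> + \<beta> - 1))" for r
  proof -
    have "integrable lebesgue (k r) \<and> (LINT t|lebesgue. k r t) = indicator {a..x} r * (Beta \<alpha> \<beta> * (T x - T r) powr (\<alpha> + \<beta> - 1))"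
    proof (cases "r \<in> {a..x}")
      case True
      then have "k r = (\<lambda>t. indicator {r..x} t *\<^sub>R ((T x - T t) powr (\<alpha> - 1) * (T t - T r) powr (\<beta> - 1) * w t))"
        using k_ind by auto
      then show ?thesis using Beta_kernel[OF \<alpha> \<beta>, of r x] x True
        by (auto simp: set_integrable_def set_lebesgue_integral_def)
    next
      case False
      then have "k r = (\<lambda>t. 0)" by (auto simp: k_def)
      then show ?thesis using False by simp
    qed
    then show "integrable lebesgue (k r)" "(LINT t|lebesgue. k r t) = indicator {a..x} r * (Beta \<alpha> \<beta> * (T x - T r) powr (\<alpha> + \<beta> - 1))" by auto
  qed
  have F_int: "integrable (lebesgue \<Otimes>\<^sub>M lebesgue) F"
  proof (rule lebesgue2.Fubini_integrable[OF F_meas])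
    have "(LINT t|lebesgue. norm (F (r,t))) = indicator {a..x} r * (Beta \<alpha> \<beta> * (T x - T' r) powr (\<alpha> + \<beta> - 1)) * norm (\<phi>' r)" for r
    proof -
      have "(LINT t|lebesgue. norm (F (r,t))) = (LINT t|lebesgue. k r t * norm (\<phi>' r))"
        using k_nn by (simp add: F_def norm_mult)
      also have "\<dots> = (LINT t|lebesgue. k r t) * norm (\<phi>' r)" by simp
      finally show ?thesis using x by (auto simp: k_val T'_def indicator_def)
    qed
    moreover have "integrable lebesgue (\<lambda>r. indicator {a..x} r * (Beta \<alpha> \<beta> * (T x - T' r) powr (\<alpha> + \<beta> - 1)) * norm (\<phi>' r))"
    proof (rule Bochner_Integration.integrable_bound)
      show "integrable lebesgue (\<lambda>r. (Beta \<alpha> \<beta> * (T x - T a) powr (\<alpha> + \<beta> - 1)) * \<phi>' r)"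
        using \<phi>'_int by auto
      show "(\<lambda>r. indicator {a..x} r * (Beta \<alpha> \<beta> * (T x - T' r) powr (\<alpha> + \<beta> - 1)) * norm (\<phi>' r)) \<in> borel_measurable lebesgue"
        by measurable
      have B: "Beta \<alpha> \<beta> > 0" using \<alpha> \<beta> by (simp add: Beta_def)
      show "AE r in lebesgue. norm (indicator {a..x} r * (Beta \<alpha> \<beta> * (T x - T' r) powr (\<alpha> + \<beta> - 1)) * norm (\<phi>' r))
          \<le> norm ((Beta \<alpha> \<beta> * (T x - T a) powr (\<alpha> + \<beta> - 1)) * \<phi>' r)"
      proof (rule AE_I2)
        fix r
        show "norm (indicator {a..x} r * (Beta \<alpha> \<beta> * (T x - T' r) powr (\<alpha> + \<beta> - 1)) * norm (\<phi>' r))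
          \<le> norm ((Beta \<alpha> \<beta> * (T x - T a) powr (\<alpha> + \<beta> - 1)) * \<phi>' r)"
        proof (cases "r \<in> {a..x}")
          case True
          then have "T' r = T r" "T a \<le> T r" "T r \<le> T x" using x T_le by (auto simp: T'_def)
          then have "(T x - T' r) powr (\<alpha> + \<beta> - 1) \<le> (T x - T a) powr (\<alpha> + \<beta> - 1)"
            using \<alpha>\<beta> by (intro powr_mono2) auto
          then show ?thesis using True B by (simp add: norm_mult abs_mult mult_left_mono mult_right_mono)
        qed simp
      qed
    qed
    ultimately show "integrable lebesgue (\<lambda>r. LINT t|lebesgue. norm (F (r,t)))" by simp
    show "AE r in lebesgue. integrable lebesgue (\<lambda>t. F (r,t))"
      using k_int by (simp add: F_def)
  qed
  have G0: "Gamma \<beta> \<noteq> 0" "Gamma \<alpha> \<noteq> 0" "Gamma (\<alpha> + \<beta>) \<noteq> 0" using Gamma_real_pos[OF \<alpha>] Gamma_real_pos[OF \<beta>] Gamma_real_pos[of "\<alpha>+\<beta>"] \<alpha> \<beta> by linarith+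
  have inner: "(LINT r|lebesgue. F (r,t)) = indicator {a..x} t *\<^sub>R (of_real (Gamma \<beta>) * (of_real ((T x - T t) powr (\<alpha> - 1)) * (of_real (w t) * frac_int \<beta> \<phi> t)))" for t
  proof (cases "t \<in> {a..x}")
    case True
    have F: "F (r,t) = of_real ((T x - T t) powr (\<alpha> - 1) * w t) * (indicator {a..t} r *\<^sub>R (of_real ((T t - T r) powr (\<beta> - 1)) * \<phi> r))" for r
      using True x by (auto simp: F_def k_def T'_def w'_def \<phi>'_def indicator_def)
    have "(LINT r|lebesgue. F (r,t)) = of_real ((T x - T t) powr (\<alpha> - 1) * w t) * (LINT r:{a..t}|lebesgue. of_real ((T t - T r) powr (\<beta> - 1)) * \<phi> r)"
      unfolding set_lebesgue_integral_def F by (rule integral_mult_right_zero)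
    then show ?thesis using True G0 by (simp add: frac_int_def)
  next
    case False
    then have "F (r,t) = 0" for r by (auto simp: F_def k_def)
    then show ?thesis using False by simp
  qed
  have cancel: "of_real (1 / Gamma \<beta>) * (of_real (Gamma \<beta>) * z) = z" for z :: complex
    using G0 by simp
  have "integrable lebesgue (\<lambda>t. LINT r|lebesgue. F (r,t))"
    by (rule lebesgue2.integrable_snd[of "\<lambda>r t. F (r,t)", simplified, OF F_int])
  then have "integrable lebesgue (\<lambda>t. of_real (Gamma \<beta>) * (indicator {a..x} t *\<^sub>R (of_real ((T x - T t) powr (\<alpha> - 1)) * (of_real (w t) * frac_int \<beta> \<phi> t))))"
    unfolding inner by (simp add: mult_scaleR_right)
  from integrable_mult_right[OF this, of "of_real (1 / Gamma \<beta>)"]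
  show int: "set_integrable lebesgue {a..x} (\<lambda>t. of_real ((T x - T t) powr (\<alpha> - 1)) * (of_real (w t) * frac_int \<beta> \<phi> t))"
    unfolding set_integrable_def cancel .
  have "(LINT t|lebesgue. LINT r|lebesgue. F (r,t)) = (LINT r|lebesgue. LINT t|lebesgue. F (r,t))"
    using lebesgue2.Fubini_integral[of "\<lambda>r t. F (r,t)"] F_int by simp
  also have "\<dots> = (LINT r|lebesgue. indicator {a..x} r *\<^sub>R (of_real (Beta \<alpha> \<beta>) * (of_real ((T x - T r) powr (\<alpha> + \<beta> - 1)) * \<phi> r)))"
  proof (intro Bochner_Integration.integral_cong refl)
    fix r
    have "(LINT t|lebesgue. F (r,t)) = (LINT t|lebesgue. complex_of_real (k r t)) * \<phi>' r"
      by (simp add: F_def)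
    also have "(LINT t|lebesgue. complex_of_real (k r t)) = of_real (LINT t|lebesgue. k r t)" by (rule integral_complex_of_real)
    finally show "(LINT t|lebesgue. F (r,t)) = indicator {a..x} r *\<^sub>R (of_real (Beta \<alpha> \<beta>) * (of_real ((T x - T r) powr (\<alpha> + \<beta> - 1)) * \<phi> r))"
      using x by (auto simp: k_val \<phi>'_def indicator_def)
  qed
  also have "\<dots> = of_real (Beta \<alpha> \<beta>) * (LINT r:{a..x}|lebesgue. of_real ((T x - T r) powr (\<alpha> + \<beta> - 1)) * \<phi> r)"
    unfolding set_lebesgue_integral_def integral_mult_right_zero[symmetric] mult_scaleR_right ..
  also have "(LINT t|lebesgue. LINT r|lebesgue. F (r,t)) = of_real (Gamma \<beta>) * (LINT t:{a..x}|lebesgue. of_real ((T x - T t) powr (\<alpha> - 1)) * (of_real (w t) * frac_int \<beta> \<phi> t))"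
    unfolding inner set_lebesgue_integral_def integral_mult_right_zero[symmetric] mult_scaleR_right ..
  finally have *: "of_real (Gamma \<beta>) * (LINT t:{a..x}|lebesgue. of_real ((T x - T t) powr (\<alpha> - 1)) * (of_real (w t) * frac_int \<beta> \<phi> t))
     = of_real (Beta \<alpha> \<beta>) * (LINT r:{a..x}|lebesgue. of_real ((T x - T r) powr (\<alpha> + \<beta> - 1)) * \<phi> r)" .
  show "frac_int \<alpha> (\<lambda>t. of_real (w t) * frac_int \<beta> \<phi> t) x = frac_int (\<alpha> + \<beta>) \<phi> x"
    using * G0 unfolding frac_int_def[of \<alpha>] frac_int_def[of "\<alpha>+\<beta>"]
    by (simp add: Beta_def field_simps)
qed

lemma frac_int_cong_AE:
  assumes "AE t in lebesgue. t \<in> {a..x} \<longrightarrow> \<phi> t = \<psi> t"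
  shows "frac_int \<beta> \<phi> x = frac_int \<beta> \<psi> x"
proof -
  have "AE t in lebesgue. t \<in> {a..x} \<longrightarrow> of_real ((T x - T t) powr (\<beta> - 1)) * \<phi> t = of_real ((T x - T t) powr (\<beta> - 1)) * \<psi> t"
    using assms by eventually_elim auto
  then show ?thesis unfolding frac_int_def by (simp only: set_lebesgue_integral_lebesgue_cong_AE(2))
qed

text \<open>
  At \<open>t = x\<close> the kernel is \<open>0 powr 0\<close>, which is \<open>0\<close> and not \<open>1\<close>.
\<close>

lemma kernel_one:
  assumes "x \<in> {a..b}"
  shows "AE t in lebesgue. t \<in> {a..x} \<longrightarrow> of_real ((T x - T t) powr (1 - 1)) * \<phi> t = (\<phi> t :: complex)"
  using AE_lebesgue_neq[of x]
proof eventually_elim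
  case (elim t)
  then show ?case using T_less[of t x] assms by auto
qed

lemma frac_int_one:
  assumes "x \<in> {a..b}"
  shows "frac_int 1 \<phi> x = (LINT t:{a..x}|lebesgue. \<phi> t)"
  unfolding frac_int_def by (simp only: set_lebesgue_integral_lebesgue_cong_AE(2)[OF kernel_one[OF assms]]) simp

lemma frac_int_weighted_integrable:
  assumes "\<beta> > 0" "set_integrable lebesgue {a..b} \<phi>"
  shows "set_integrable lebesgue {a..b} (\<lambda>t. of_real (w t) * frac_int \<beta> \<phi> t)"
  using frac_int_semigroup(1)[of 1 \<beta> \<phi> b] set_lebesgue_integral_lebesgue_cong_AE(1)[OF kernel_one[of b]] assms ab by simp

text \<open>
  The coefficient \<open>rGamma \<beta>\<close> normalises powers so that fractional integration merely shifts the
  exponent.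
\<close>

lemma power_kernel:
  fixes c :: complex
  assumes \<alpha>: "\<alpha> > 0" and \<beta>: "\<beta> > 0" and x: "x \<in> {a..b}"
  defines "\<phi> \<equiv> \<lambda>t. of_real (w t) * (of_real (rGamma \<beta> * (T t - T a) powr (\<beta> - 1)) * c)"
  shows "set_integrable lebesgue {a..x} (\<lambda>t. of_real ((T x - T t) powr (\<alpha> - 1)) * \<phi> t)"
    and "frac_int \<alpha> \<phi> x = of_real (rGamma (\<alpha> + \<beta>) * (T x - T a) powr (\<alpha> + \<beta> - 1)) * c"
proof -
  let ?k = "\<lambda>t. (T x - T t) powr (\<alpha> - 1) * (T t - T a) powr (\<beta> - 1) * w t"
  have k: "set_integrable lebesgue {a..x} ?k" "(LINT t:{a..x}|lebesgue. ?k t) = Beta \<alpha> \<beta> * (T x - T a) powr (\<alpha> + \<beta> - 1)"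
    using Beta_kernel[OF \<alpha> \<beta>, of a x] x by auto
  have eq: "of_real ((T x - T t) powr (\<alpha> - 1)) * \<phi> t = (of_real (rGamma \<beta>) * c) * of_real (?k t)" for t
    by (simp add: \<phi>_def)
  have kc: "set_integrable lebesgue {a..x} (\<lambda>t. complex_of_real (?k t))"
    using integrable_of_real[OF k(1)[unfolded set_integrable_def], where 'a=complex]
    by (simp add: set_integrable_def scaleR_conv_of_real)
  have "(LINT t:{a..x}|lebesgue. complex_of_real (?k t)) = of_real (LINT t:{a..x}|lebesgue. ?k t)"
    unfolding set_lebesgue_integral_def integral_complex_of_real[symmetric]
    by (simp add: scaleR_conv_of_real)
  with k(2) have kv: "(LINT t:{a..x}|lebesgue. complex_of_real (?k t)) = of_real (Beta \<alpha> \<beta> * (T x - T a) powr (\<alpha> + \<beta> - 1))" by simp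
  show "set_integrable lebesgue {a..x} (\<lambda>t. of_real ((T x - T t) powr (\<alpha> - 1)) * \<phi> t)"
    unfolding eq using kc by (intro set_integrable_mult_right)
  have G: "Gamma \<alpha> \<noteq> 0" "Gamma \<beta> \<noteq> 0" "Gamma (\<alpha> + \<beta>) \<noteq> 0"
    using Gamma_real_pos[OF \<alpha>] Gamma_real_pos[OF \<beta>] Gamma_real_pos[of "\<alpha> + \<beta>"] \<alpha> \<beta> by linarith+
  have "frac_int \<alpha> \<phi> x = of_real (1 / Gamma \<alpha>) * ((of_real (rGamma \<beta>) * c) * of_real (Beta \<alpha> \<beta> * (T x - T a) powr (\<alpha> + \<beta> - 1)))"
    unfolding frac_int_def eq set_integral_mult_right kv ..
  also have "\<dots> = of_real (1 / Gamma \<alpha> * rGamma \<beta> * Beta \<alpha> \<beta>) * (of_real ((T x - T a) powr (\<alpha> + \<beta> - 1)) * c)"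
    by simp
  also have "1 / Gamma \<alpha> * rGamma \<beta> * Beta \<alpha> \<beta> = rGamma (\<alpha> + \<beta>)"
    using G by (simp add: Beta_def rGamma_inverse_Gamma field_simps)
  finally show "frac_int \<alpha> \<phi> x = of_real (rGamma (\<alpha> + \<beta>) * (T x - T a) powr (\<alpha> + \<beta> - 1)) * c" by simp
qed

lemma frac_int_add:
  assumes "set_integrable lebesgue {a..x} (\<lambda>t. of_real ((T x - T t) powr (\<beta> - 1)) * \<phi> t)"
    and "set_integrable lebesgue {a..x} (\<lambda>t. of_real ((T x - T t) powr (\<beta> - 1)) * \<psi> t)"
  shows "frac_int \<beta> (\<lambda>t. \<phi> t + \<psi> t) x = frac_int \<beta> \<phi> x + frac_int \<beta> \<psi> x"
  using set_integral_add(2)[OF assms] by (simp add: frac_int_def distrib_left)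

lemma frac_int_sum:
  assumes "finite J" "\<And>j. j \<in> J \<Longrightarrow> set_integrable lebesgue {a..x} (\<lambda>t. of_real ((T x - T t) powr (\<beta> - 1)) * \<phi> j t)"
  shows "set_integrable lebesgue {a..x} (\<lambda>t. of_real ((T x - T t) powr (\<beta> - 1)) * (\<Sum>j\<in>J. \<phi> j t))"
    and "frac_int \<beta> (\<lambda>t. \<Sum>j\<in>J. \<phi> j t) x = (\<Sum>j\<in>J. frac_int \<beta> (\<phi> j) x)"
proof -
  have "set_integrable lebesgue {a..x} (\<lambda>t. of_real ((T x - T t) powr (\<beta> - 1)) * (\<Sum>j\<in>J. \<phi> j t))
    \<and> frac_int \<beta> (\<lambda>t. \<Sum>j\<in>J. \<phi> j t) x = (\<Sum>j\<in>J. frac_int \<beta> (\<phi> j) x)"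
    using assms
  proof (induction J rule: finite_induct)
    case empty
    then show ?case by (simp add: frac_int_def set_integrable_def)
  next
    case (insert i J)
    then show ?case using set_integral_add(1)[of lebesgue "{a..x}" "\<lambda>t. of_real ((T x - T t) powr (\<beta> - 1)) * \<phi> i t" "\<lambda>t. of_real ((T x - T t) powr (\<beta> - 1)) * (\<Sum>j\<in>J. \<phi> j t)"]
        frac_int_add[of x \<beta> "\<phi> i" "\<lambda>t. \<Sum>j\<in>J. \<phi> j t"]
      by (simp add: distrib_left)
  qed
  then show "set_integrable lebesgue {a..x} (\<lambda>t. of_real ((T x - T t) powr (\<beta> - 1)) * (\<Sum>j\<in>J. \<phi> j t))"
    and "frac_int \<beta> (\<lambda>t. \<Sum>j\<in>J. \<phi> j t) x = (\<Sum>j\<in>J. frac_int \<beta> (\<phi> j) x)" by auto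
qed

lemma indefinite_integral_continuous_on:
  assumes "set_integrable lebesgue {a..b} (\<phi> :: real \<Rightarrow> complex)"
  shows "continuous_on {a..b} (\<lambda>x. LINT t:{a..x}|lebesgue. \<phi> t)"
proof -
  have "continuous_on {a..b} (\<lambda>x. integral {a..x} \<phi>)"
    by (rule indefinite_integral_continuous_1) (rule set_lebesgue_integral_eq_integral(1)[OF assms])
  then show ?thesis
  proof (rule continuous_on_eq)
    show "integral {a..x} \<phi> = (LINT t:{a..x}|lebesgue. \<phi> t)" if "x \<in> {a..b}" for x
    using that by (intro set_lebesgue_integral_eq_integral(2)[symmetric] set_integrable_subset[OF assms]) auto
  qed
qed

lemma T_pos: "x \<in> {a<..b} \<Longrightarrow> T x - T a > 0"
  using T_less[of a x] by auto

text \<open>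
  The point \<open>a\<close> is left out because \<open>0 powr 0 = 0\<close> and because a fractional integral and its
  continuous representative may differ there.
\<close>

lemma AE_Ioc:
  assumes "x \<in> {a..b}" "\<And>t. t \<in> {a<..b} \<Longrightarrow> P t"
  shows "AE t in lebesgue. t \<in> {a..x} \<longrightarrow> P t"
  using AE_lebesgue_neq[of a] by eventually_elim (use assms in auto)

text \<open>
  Induction on \<open>m\<close>: write \<open>G m\<close> in the remainder as \<open>G m a\<close> plus a first order integral. The constant
  contributes the next power, and the semigroup law merges the integral into the remainder. The
  exponents appear as \<open>real j + 1 - 1\<close> to match \<open>power_kernel\<close>.
\<close>

lemma taylor:
  fixes G :: "nat \<Rightarrow> real \<Rightarrow> complex"
  assumes m: "m \<ge> 1"
    and int: "\<And>j. j < m \<Longrightarrow> set_integrable lebesgue {a..b} (\<lambda>t. of_real (w t) * G (Suc j) t)"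
    and ftc: "\<And>j x. j < m \<Longrightarrow> x \<in> {a..b} \<Longrightarrow> G j x = G j a + (LINT t:{a..x}|lebesgue. of_real (w t) * G (Suc j) t)"
    and x: "x \<in> {a<..b}"
  shows "G 0 x = (\<Sum>j<m. of_real (rGamma (real j + 1) * (T x - T a) powr (real j + 1 - 1)) * G j a)
           + frac_int (real m) (\<lambda>t. of_real (w t) * G m t) x"
  using m int ftc
proof (induction m rule: nat_induct_at_least)
  case base
  have "G 0 x = G 0 a + (LINT t:{a..x}|lebesgue. of_real (w t) * G (Suc 0) t)"
    using x by (intro base.prems(2)) auto
  then show ?case using x T_pos[OF x] by (simp add: frac_int_one)
next
  case (Suc m)
  have x': "x \<in> {a..b}" using x by simp
  have m0: "real m > 0" using Suc.hyps by simp
  have i: "set_integrable lebesgue {a..b} (\<lambda>t. of_real (w t) * G (Suc m) t)" using Suc.prems(1) by simp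
  let ?c = "\<lambda>t. of_real (w t) * (of_real (rGamma 1 * (T t - T a) powr (1 - 1)) * G m a)"
  let ?r = "\<lambda>t. of_real (w t) * frac_int 1 (\<lambda>t. of_real (w t) * G (Suc m) t) t"
  have "frac_int (real m) (\<lambda>t. of_real (w t) * G m t) x = frac_int (real m) (\<lambda>t. ?c t + ?r t) x"
  proof (rule frac_int_cong_AE, rule AE_Ioc[OF x'])
    fix t assume t: "t \<in> {a<..b}"
    have "G m t = G m a + frac_int 1 (\<lambda>t. of_real (w t) * G (Suc m) t) t"
      using Suc.prems(2)[of m t] t by (simp add: frac_int_one)
    then show "of_real (w t) * G m t = ?c t + ?r t"
      using T_pos[OF t] by (simp add: distrib_left)
  qed
  also have "\<dots> = frac_int (real m) ?c x + frac_int (real m) ?r x"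
    using Suc.hyps by (intro frac_int_add power_kernel(1)[OF m0 zero_less_one x'] frac_int_semigroup(1)[OF m0 zero_less_one _ i x']) auto
  also have "frac_int (real m) ?c x = of_real (rGamma (real m + 1) * (T x - T a) powr (real m + 1 - 1)) * G m a"
    by (rule power_kernel(2)[OF m0 zero_less_one x'])
  also have "frac_int (real m) ?r x = frac_int (real m + 1) (\<lambda>t. of_real (w t) * G (Suc m) t) x"
    using Suc.hyps by (intro frac_int_semigroup(2)[OF m0 zero_less_one _ i x']) auto
  finally have "frac_int (real m) (\<lambda>t. of_real (w t) * G m t) x =
    of_real (rGamma (real m + 1) * (T x - T a) powr (real m + 1 - 1)) * G m a
    + frac_int (real (Suc m)) (\<lambda>t. of_real (w t) * G (Suc m) t) x" by (simp add: add.commute)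
  moreover have "G 0 x = (\<Sum>j<m. of_real (rGamma (real j + 1) * (T x - T a) powr (real j + 1 - 1)) * G j a)
           + frac_int (real m) (\<lambda>t. of_real (w t) * G m t) x"
    by (rule Suc.IH) (intro Suc.prems; simp)+
  ultimately show ?case by simp
qed

text \<open>
  The functions \<open>G 0, \<dots>, G n\<close> play the role of the successive derivatives \<open>(1 / w) d/dx\<close> of the integral of
  order \<open>n - \<mu>\<close>. Both sides of the claim are shown to have the same indefinite integral.
\<close>

theorem frac_int_inversion:
  fixes G :: "nat \<Rightarrow> real \<Rightarrow> complex"
  assumes \<mu>: "\<mu> > 0" and n: "real n - \<mu> > 0" "real n - \<mu> \<le> 1"
    and \<phi>: "set_integrable lebesgue {a..b} \<phi>"
    and int: "\<And>j. j < n \<Longrightarrow> set_integrable lebesgue {a..b} (\<lambda>t. of_real (w t) * G (Suc j) t)"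
    and ftc: "\<And>j x. j < n \<Longrightarrow> x \<in> {a..b} \<Longrightarrow> G j x = G j a + (LINT t:{a..x}|lebesgue. of_real (w t) * G (Suc j) t)"
    and G0: "\<And>x. x \<in> {a<..b} \<Longrightarrow> G 0 x = frac_int (real n - \<mu>) \<phi> x"
  shows "AE x in lebesgue. x \<in> {a..b} \<longrightarrow>
     \<phi> x = of_real (w x) * ((\<Sum>j<n. of_real (rGamma (\<mu> - real n + real j + 1) * (T x - T a) powr (\<mu> - real n + real j)) * G j a)
           + frac_int \<mu> (\<lambda>t. of_real (w t) * G n t) x)"
proof -
  have n1: "n \<ge> 1" using n \<mu> by (cases n) auto
  have iGn: "set_integrable lebesgue {a..b} (\<lambda>t. of_real (w t) * G n t)" using int[of "n - 1"] n1 by simp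
  define \<alpha> where "\<alpha> = real n - \<mu>"
  have \<alpha>: "\<alpha> > 0" "\<alpha> \<le> 1" using n by (auto simp: \<alpha>_def)
  let ?P = "\<lambda>p c x. of_real (rGamma p * (T x - T a) powr (p - 1)) * (c::complex)"
  let ?r = "\<lambda>t. of_real (w t) * G n t"
  have one: "frac_int 1 \<phi> x = (\<Sum>j<n. ?P (1 - \<alpha> + (real j + 1)) (G j a) x) + frac_int (1 + \<mu>) ?r x" if x: "x \<in> {a<..b}" for x
  proof (cases "\<alpha> = 1")
    case True
    then have "real n = 1 + \<mu>" by (simp add: \<alpha>_def)
    then show ?thesis using taylor[where G=G, OF n1 int ftc x] G0[OF x] True by (simp add: \<alpha>_def)
  next
    case False
    with \<alpha> have \<alpha>1: "1 - \<alpha> > 0" by simp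
    have x': "x \<in> {a..b}" using x by simp
    have "frac_int 1 \<phi> x = frac_int (1 - \<alpha>) (\<lambda>t. of_real (w t) * frac_int \<alpha> \<phi> t) x"
      using frac_int_semigroup(2)[OF \<alpha>1 \<alpha>(1) _ \<phi> x'] by simp
    also have "\<dots> = frac_int (1 - \<alpha>) (\<lambda>t. (\<Sum>j<n. of_real (w t) * ?P (real j + 1) (G j a) t) + of_real (w t) * frac_int (real n) ?r t) x"
    proof (rule frac_int_cong_AE, rule AE_Ioc[OF x'])
      fix t assume t: "t \<in> {a<..b}"
      show "of_real (w t) * frac_int \<alpha> \<phi> t = (\<Sum>j<n. of_real (w t) * ?P (real j + 1) (G j a) t) + of_real (w t) * frac_int (real n) ?r t"
        using taylor[where G=G, OF n1 int ftc t] G0[OF t] by (simp only: \<alpha>_def distrib_left sum_distrib_left)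
    qed
    also have "\<dots> = frac_int (1 - \<alpha>) (\<lambda>t. \<Sum>j<n. of_real (w t) * ?P (real j + 1) (G j a) t) x + frac_int (1 - \<alpha>) (\<lambda>t. of_real (w t) * frac_int (real n) ?r t) x"
      using n1 \<alpha>1 by (intro frac_int_add frac_int_sum(1) power_kernel(1) frac_int_semigroup(1)[OF _ _ _ iGn x'] x') auto
    also have "frac_int (1 - \<alpha>) (\<lambda>t. \<Sum>j<n. of_real (w t) * ?P (real j + 1) (G j a) t) x = (\<Sum>j<n. frac_int (1 - \<alpha>) (\<lambda>t. of_real (w t) * ?P (real j + 1) (G j a) t) x)"
      using \<alpha>1 x' by (intro frac_int_sum(2) power_kernel(1)) auto
    also have "\<dots> = (\<Sum>j<n. ?P (1 - \<alpha> + (real j + 1)) (G j a) x)"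
      using \<alpha>1 x' by (intro sum.cong refl power_kernel(2)) auto
    also have "frac_int (1 - \<alpha>) (\<lambda>t. of_real (w t) * frac_int (real n) ?r t) x = frac_int (1 - \<alpha> + real n) ?r x"
      using n1 \<alpha>1 by (intro frac_int_semigroup(2)[OF _ _ _ iGn x']) auto
    also have "1 - \<alpha> + real n = 1 + \<mu>" by (simp add: \<alpha>_def)
    finally show ?thesis .
  qed
  \<comment> \<open>For integral \<open>\<mu>\<close> the function \<open>G 0\<close> is the indefinite integral of \<open>\<phi>\<close> on \<open>{a<..b}\<close> and is continuous at \<open>a\<close>.\<close>
  have zero: "G 0 a = 0" if "\<alpha> = 1"
  proof -
    let ?D = "\<lambda>x. (LINT t:{a..x}|lebesgue. \<phi> t) - (LINT t:{a..x}|lebesgue. of_real (w t) * G (Suc 0) t)"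
    have cont: "continuous_on {a..b} ?D"
      using n1 by (intro continuous_on_diff indefinite_integral_continuous_on \<phi> int) auto
    have "(?D \<longlongrightarrow> ?D a) (at a within {a..b})"
      by (rule continuous_on[THEN iffD1, rule_format, OF cont]) (use ab in simp)
    moreover have "?D a = 0" by (simp only: set_integral_point diff_self)
    moreover have "?D x = G 0 a" if "x \<in> {a<..b}" for x
      using G0[OF that] ftc[of 0 x] n1 that \<open>\<alpha> = 1\<close> by (simp add: \<alpha>_def frac_int_one)
    then have "(?D \<longlongrightarrow> G 0 a) (at a within {a..b})"
      by (intro tendsto_eventually) (auto simp: eventually_at intro!: exI[of _ 1])
    ultimately show "G 0 a = 0"
      using tendsto_unique[of "at a within {a..b}" ?D] ab by (auto simp: trivial_limit_within islimpt_Icc)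
  qed
  \<comment> \<open>The summands of the claim times \<open>w\<close>; the exceptional case is \<open>j = 0\<close>, \<open>\<alpha> = 1\<close>, where the power is not integrable.\<close>
  let ?Q = "\<lambda>j t. if 1 - \<alpha> + real j = 0 then 0 else of_real (w t) * ?P (1 - \<alpha> + real j) (G j a) t"
  have Q: "set_integrable lebesgue {a..b} (?Q j) \<and> (x \<in> {a..b} \<longrightarrow> (LINT t:{a..x}|lebesgue. ?Q j t) = ?P (1 - \<alpha> + (real j + 1)) (G j a) x)" for j x
  proof (cases "1 - \<alpha> + real j = 0")
    case True
    then have "j = 0" "\<alpha> = 1" using \<alpha> by auto
    then show ?thesis using zero by (simp add: set_integrable_def)
  next
    case False
    then have p: "1 - \<alpha> + real j > 0" using \<alpha> by auto
    let ?f = "\<lambda>t. of_real (w t) * ?P (1 - \<alpha> + real j) (G j a) t"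
    have "set_integrable lebesgue {a..b} ?f"
      using power_kernel(1)[OF zero_less_one p, of b] set_lebesgue_integral_lebesgue_cong_AE(1)[OF kernel_one[of b ?f]] ab by simp
    moreover have "(LINT t:{a..x}|lebesgue. ?f t) = ?P (1 - \<alpha> + (real j + 1)) (G j a) x" if "x \<in> {a..b}"
    proof -
      have "(LINT t:{a..x}|lebesgue. ?f t) = frac_int 1 ?f x" by (rule frac_int_one[OF that, symmetric])
      also have "\<dots> = ?P (1 + (1 - \<alpha> + real j)) (G j a) x" by (rule power_kernel(2)[OF zero_less_one p that])
      finally show ?thesis by (simp add: algebra_simps)
    qed
    ultimately show ?thesis using False by simp
  qed
  let ?R = "\<lambda>t. of_real (w t) * frac_int \<mu> ?r t"
  let ?\<psi> = "\<lambda>t. (\<Sum>j<n. ?Q j t) + ?R t"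
  have iR: "set_integrable lebesgue {a..b} ?R" by (rule frac_int_weighted_integrable[OF \<mu> iGn])
  have iS: "set_integrable lebesgue {a..b} (\<lambda>t. \<Sum>j<n. ?Q j t)"
    using Q unfolding set_integrable_def scaleR_sum_right by (intro Bochner_Integration.integrable_sum) auto
  have sub: "set_integrable lebesgue {a..x} f" if "set_integrable lebesgue {a..b} f" "x \<in> {a..b}" for f :: "real \<Rightarrow> complex" and x
    using that by (intro set_integrable_subset[OF that(1)]) auto
  have "AE x in lebesgue. x \<in> {a..b} \<longrightarrow> \<phi> x - ?\<psi> x = 0"
  proof (rule zero_integrals_imp_zero_AE)
    show "set_integrable lebesgue {a..b} (\<lambda>x. \<phi> x - ?\<psi> x)"
      by (intro set_integral_diff(1) set_integral_add(1) \<phi> iR iS)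
    fix x assume x: "x \<in> {a..b}"
    show "(LINT t:{a..x}|lebesgue. \<phi> t - ?\<psi> t) = 0"
    proof (cases "x = a")
      case True
      show ?thesis unfolding True by (rule set_integral_point)
    next
      case False
      then have x': "x \<in> {a<..b}" using x by auto
      have "(LINT t:{a..x}|lebesgue. \<phi> t - ?\<psi> t) = (LINT t:{a..x}|lebesgue. \<phi> t) - ((LINT t:{a..x}|lebesgue. \<Sum>j<n. ?Q j t) + (LINT t:{a..x}|lebesgue. ?R t))"
        using set_integral_diff(2)[OF sub[OF \<phi> x] set_integral_add(1)[OF sub[OF iS x] sub[OF iR x]]]
          set_integral_add(2)[OF sub[OF iS x] sub[OF iR x]] by simp
      also have "(LINT t:{a..x}|lebesgue. ?R t) = frac_int (1 + \<mu>) ?r x"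
        using frac_int_semigroup(2)[OF zero_less_one \<mu> _ iGn x] frac_int_one[OF x, of ?R] \<mu> by simp
      also have "(LINT t:{a..x}|lebesgue. \<Sum>j<n. ?Q j t) = (\<Sum>j<n. LINT t:{a..x}|lebesgue. ?Q j t)"
        unfolding set_lebesgue_integral_def scaleR_sum_right
        using sub[OF Q[THEN conjunct1] x] by (intro Bochner_Integration.integral_sum) (simp add: set_integrable_def)
      also have "\<dots> = (\<Sum>j<n. ?P (1 - \<alpha> + (real j + 1)) (G j a) x)"
        using Q x by (intro sum.cong refl) blast
      finally show ?thesis using one[OF x'] frac_int_one[OF x, of \<phi>] by simp
    qed
  qed
  then show ?thesis
  proof eventually_elim
    case (elim x)
    show ?case
    proof
      assume x: "x \<in> {a..b}"
      have "?Q j x = of_real (w x) * (of_real (rGamma (\<mu> - real n + real j + 1) * (T x - T a) powr (\<mu> - real n + real j)) * G j a)" for j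
      proof -
        have e: "1 - \<alpha> + real j = \<mu> - real n + real j + 1" by (simp add: \<alpha>_def)
        show ?thesis unfolding e by auto
      qed
      then have "?\<psi> x = of_real (w x) * ((\<Sum>j<n. of_real (rGamma (\<mu> - real n + real j + 1) * (T x - T a) powr (\<mu> - real n + real j)) * G j a) + frac_int \<mu> ?r x)"
        by (simp only: sum_distrib_left distrib_left)
      then show "\<phi> x = of_real (w x) * ((\<Sum>j<n. of_real (rGamma (\<mu> - real n + real j + 1) * (T x - T a) powr (\<mu> - real n + real j)) * G j a) + frac_int \<mu> ?r x)"
        using elim x by simp
    qed
  qed
qed

end

section \<open>Hadamard operators\<close>

locale hadamard_scale =
  fixes a b :: real and \<Psi> :: "real \<Rightarrow> real"
  assumes less: "a < b"
    and C1: "C1_on a b \<Psi>"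
    and mono: "mono_on {a..b} \<Psi>"
    and pos: "\<forall>x\<in>{a..b}. \<Psi> x > 0"
    and deriv_nz: "\<forall>x\<in>{a..b}. deriv_on a b \<Psi> x \<noteq> 0"
begin

definition wt :: "real \<Rightarrow> real" where "wt x = deriv_on a b \<Psi> x / \<Psi> x"

lemma \<Psi>_deriv: "(\<Psi> has_field_derivative deriv_on a b \<Psi> x) (at x within {a..b})" if "x \<in> {a..b}"
  using C1 that unfolding C1_on_def has_real_derivative_iff_has_vector_derivative
  by (simp add: vector_derivative_works)

lemma \<Psi>_deriv_pos: "deriv_on a b \<Psi> x > 0" if x: "x \<in> {a..b}"
proof -
  have nt: "at x within {a..b} \<noteq> bot" using x less by (simp add: trivial_limit_within islimpt_Icc)
  have "((\<lambda>y. (\<Psi> y - \<Psi> x) / (y - x)) \<longlongrightarrow> deriv_on a b \<Psi> x) (at x within {a..b})"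
    using \<Psi>_deriv[OF x] by (simp add: has_field_derivative_iff)
  moreover have "\<forall>\<^sub>F y in at x within {a..b}. 0 \<le> (\<Psi> y - \<Psi> x) / (y - x)"
  proof (rule eventually_at_topological[THEN iffD2], intro exI[of _ UNIV] conjI ballI impI)
    fix y assume "y \<noteq> x" "y \<in> {a..b}"
    then show "0 \<le> (\<Psi> y - \<Psi> x) / (y - x)"
      using monotone_onD[OF mono, of x y] monotone_onD[OF mono, of y x] x
      by (cases "x < y") (auto simp: divide_nonneg_pos divide_nonpos_neg)
  qed auto
  ultimately have "0 \<le> deriv_on a b \<Psi> x" using nt by (intro tendsto_lowerbound)
  then show ?thesis using deriv_nz x by force
qed

lemma \<Psi>_cont: "continuous_on {a..b} \<Psi>"
  using \<Psi>_deriv by (meson DERIV_continuous continuous_on_eq_continuous_within)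

lemma wt_cont: "continuous_on {a..b} wt"
  unfolding wt_def using C1 \<Psi>_cont pos by (intro continuous_intros) (auto simp: C1_on_def)

sublocale change_of_time a b "\<lambda>x. ln (\<Psi> x)" wt
proof
  show "a < b" by (rule less)
  show "((\<lambda>x. ln (\<Psi> x)) has_real_derivative wt x) (at x within {a..b})" if "x \<in> {a..b}" for x
    using that pos by (auto intro!: derivative_eq_intros \<Psi>_deriv simp: wt_def)
  show "continuous_on {a..b} wt" by (rule wt_cont)
  show "0 < wt x" if "x \<in> {a..b}" for x
    using that pos \<Psi>_deriv_pos by (simp add: wt_def)
qed

lemma hadamard_I_eq_frac_int:
  assumes x: "x \<in> {a..b}"
  shows "hadamard_I a b \<Psi> s \<mu> f x =
    of_real (\<Psi> x powr - s) * frac_int \<mu> (\<lambda>t. of_real (wt t) * (of_real (\<Psi> t powr s) * f t)) x"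
proof -
  have "of_real ((\<Psi> t / \<Psi> x) powr s * ln (\<Psi> x / \<Psi> t) powr (\<mu> - 1)) * f t * of_real (deriv_on a b \<Psi> t / \<Psi> t)
      = of_real (\<Psi> x powr - s) * (of_real ((ln (\<Psi> x) - ln (\<Psi> t)) powr (\<mu> - 1)) * (of_real (wt t) * (of_real (\<Psi> t powr s) * f t)))"
    if "t \<in> {a..x}" for t
  proof -
    have "\<Psi> t > 0" "\<Psi> x > 0" using that x pos by auto
    then have "(\<Psi> t / \<Psi> x) powr s = \<Psi> x powr - s * \<Psi> t powr s" "ln (\<Psi> x / \<Psi> t) = ln (\<Psi> x) - ln (\<Psi> t)"
      by (auto simp: powr_divide powr_minus_divide ln_div)
    then show ?thesis by (simp add: wt_def)
  qed
  then have "(LINT t:{a..x}|lebesgue. of_real ((\<Psi> t / \<Psi> x) powr s * ln (\<Psi> x / \<Psi> t) powr (\<mu> - 1)) * f t * of_real (deriv_on a b \<Psi> t / \<Psi> t))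
     = (LINT t:{a..x}|lebesgue. of_real (\<Psi> x powr - s) * (of_real ((ln (\<Psi> x) - ln (\<Psi> t)) powr (\<mu> - 1)) * (of_real (wt t) * (of_real (\<Psi> t powr s) * f t))))"
    by (intro set_lebesgue_integral_cong) auto
  then show ?thesis unfolding hadamard_I_def frac_int_def set_integral_mult_right by simp
qed

lemma wt_\<Psi>delta:
  assumes "x \<in> {a..b}"
  shows "of_real (wt x) * \<Psi>delta a b \<Psi> g x = deriv_on a b g x"
proof -
  have "\<Psi> x > 0" "deriv_on a b \<Psi> x \<noteq> 0" using assms pos deriv_nz by blast+
  then show ?thesis by (simp add: wt_def \<Psi>delta_def)
qed

text \<open>
  Derivatives at points of \<open>{a<..b}\<close> do not see the value at \<open>a\<close>, where the Hadamard integral is \<open>0\<close>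
  as an integral over a null set and may differ from its continuous representative.
\<close>

lemma \<Psi>delta_pow_cong:
  assumes "\<And>x. x \<in> {a<..b} \<Longrightarrow> u x = v x" "x \<in> {a<..b}"
  shows "(\<Psi>delta a b \<Psi> ^^ j) u x = (\<Psi>delta a b \<Psi> ^^ j) v x"
  using assms(2)
proof (induction j arbitrary: x)
  case 0
  then show ?case using assms(1) by simp
next
  case (Suc j)
  have "\<forall>\<^sub>F y in nhds x. y \<in> {a<..}" using Suc.prems by (intro eventually_nhds_in_open) auto
  then have "deriv_on a b ((\<Psi>delta a b \<Psi> ^^ j) u) x = deriv_on a b ((\<Psi>delta a b \<Psi> ^^ j) v) x"
    using Suc by (intro vector_derivative_cong_eq) (auto elim!: eventually_mono)
  then show ?case
    by (simp add: \<Psi>delta_def[of _ _ _ "(\<Psi>delta a b \<Psi> ^^ j) u"] \<Psi>delta_def[of _ _ _ "(\<Psi>delta a b \<Psi> ^^ j) v"])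
qed

text \<open>
  Below the top order the derivatives are continuous and the usual fundamental theorem applies; the
  top order is the absolutely continuous case.
\<close>

lemma AC_delta_ftc:
  assumes n: "n \<ge> 1" and h: "h \<in> AC_delta a b \<Psi> s n"
  defines "G \<equiv> \<lambda>j. (\<Psi>delta a b \<Psi> ^^ j) (\<lambda>x. of_real (\<Psi> x powr s) * h x)"
  assumes j: "j < n"
  shows "set_integrable lebesgue {a..b} (\<lambda>t. of_real (wt t) * G (Suc j) t)"
    and "\<And>x. x \<in> {a..b} \<Longrightarrow> G j x = G j a + (LINT t:{a..x}|lebesgue. of_real (wt t) * G (Suc j) t)"
    and "continuous_on {a..b} (G j)"
proof -
  have diff: "G i differentiable (at x within {a..b})" if "i < n - 1" "x \<in> {a..b}" for i x
    using h that by (auto simp: AC_delta_def G_def Let_def)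
  have ac: "ac_on a b (G (n - 1))"
    using h by (simp add: AC_delta_def G_def Let_def ac_on_def abs_continuous_on_def)
  have wG: "of_real (wt x) * G (Suc i) x = deriv_on a b (G i) x" if "x \<in> {a..b}" for x i
    using wt_\<Psi>delta[OF that] by (simp add: G_def)
  have restrict: "set_integrable lebesgue {a..b} (\<lambda>t. of_real (wt t) * G (Suc i) t) = set_integrable lebesgue {a..b} (deriv_on a b (G i))" for i
    by (rule set_integrable_cong[OF refl refl wG])
  have LINT: "(LINT t:{a..x}|lebesgue. of_real (wt t) * G (Suc i) t) = integral {a..x} (deriv_on a b (G i))"
    if "x \<in> {a..b}" "set_integrable lebesgue {a..b} (deriv_on a b (G i))" for x i
  proof -
    have "(LINT t:{a..x}|lebesgue. of_real (wt t) * G (Suc i) t) = (LINT t:{a..x}|lebesgue. deriv_on a b (G i) t)"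
      using wG that by (intro set_lebesgue_integral_cong) auto
    also have "\<dots> = integral {a..x} (deriv_on a b (G i))"
      using that by (intro set_lebesgue_integral_eq_integral(2) set_integrable_subset[OF that(2)]) auto
    finally show ?thesis .
  qed
  have top: "set_integrable lebesgue {a..b} (\<lambda>t. of_real (wt t) * G (Suc (n - 1)) t)"
    "\<And>x. x \<in> {a..b} \<Longrightarrow> G (n - 1) x = G (n - 1) a + (LINT t:{a..x}|lebesgue. of_real (wt t) * G (Suc (n - 1)) t)"
    using ac_complex_ftc[OF ac less] LINT restrict by auto
  have cont: "continuous_on {a..b} (G i)" if "i < n" for i
  proof (cases "i = n - 1")
    case True
    have "continuous_on {a..b} (\<lambda>x. G (n - 1) a + (LINT t:{a..x}|lebesgue. of_real (wt t) * G (Suc (n - 1)) t))"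
      by (intro continuous_on_add continuous_on_const indefinite_integral_continuous_on top)
    then show ?thesis unfolding True by (rule continuous_on_eq) (rule top(2)[symmetric])
  next
    case False
    then show ?thesis using diff[of i] that
      by (auto simp: continuous_on_eq_continuous_within intro: differentiable_imp_continuous_within)
  qed
  show "continuous_on {a..b} (G j)" by (rule cont[OF j])
  have "set_integrable lebesgue {a..b} (\<lambda>t. of_real (wt t) * G (Suc j) t) \<and>
    (\<forall>x\<in>{a..b}. G j x = G j a + (LINT t:{a..x}|lebesgue. of_real (wt t) * G (Suc j) t))"
  proof (cases "j = n - 1")
    case True
    then show ?thesis using top by blast
  next
    case False
    then have j': "j < n - 1" using j by simp
    have "continuous_on {a..b} (\<lambda>t. of_real (wt t) * G (Suc j) t)"
      using j' by (intro continuous_on_mult continuous_on_of_real wt_cont cont) simp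
    then have int: "set_integrable lebesgue {a..b} (\<lambda>t. of_real (wt t) * G (Suc j) t)"
      by (rule absolutely_integrable_continuous_real)
    moreover have "G j x = G j a + (LINT t:{a..x}|lebesgue. of_real (wt t) * G (Suc j) t)" if x: "x \<in> {a..b}" for x
    proof -
      have "(deriv_on a b (G j) has_integral (G j x - G j a)) {a..x}"
      proof (rule fundamental_theorem_of_calculus)
        show "(G j has_vector_derivative deriv_on a b (G j) y) (at y within {a..x})" if "y \<in> {a..x}" for y
        proof (rule has_vector_derivative_within_subset)
          show "(G j has_vector_derivative deriv_on a b (G j) y) (at y within {a..b})"
            using diff[OF j', of y] that x by (simp add: vector_derivative_works)
        qed (use x in auto)
      qed (use x in auto)
      then have "integral {a..x} (deriv_on a b (G j)) = G j x - G j a" by (rule integral_unique)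
      then show ?thesis using LINT[OF x] int restrict by simp
    qed
    ultimately show ?thesis by blast
  qed
  then show "set_integrable lebesgue {a..b} (\<lambda>t. of_real (wt t) * G (Suc j) t)"
    and "\<And>x. x \<in> {a..b} \<Longrightarrow> G j x = G j a + (LINT t:{a..x}|lebesgue. of_real (wt t) * G (Suc j) t)" by blast+
qed

text \<open>
  For \<open>k < n\<close> the derivative of order \<open>\<mu> - k\<close> again starts from the integral of order \<open>n - \<mu>\<close>, because
  \<open>\<lfloor>\<mu> - k\<rfloor> + 1 = n - k\<close>; for \<open>k = n\<close> it is this integral by the convention for negative orders.
\<close>

lemma hadamard_RL_eq:
  assumes \<mu>: "\<mu> > 0" and n: "n = nat \<lfloor>\<mu>\<rfloor> + 1" and k: "k \<le> n" and x: "x \<in> {a<..b}"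
    and h: "\<And>x. x \<in> {a<..b} \<Longrightarrow> h x = hadamard_I a b \<Psi> s (real n - \<mu>) f x"
  shows "hadamard_RL a b \<Psi> s (\<mu> - real k) f x =
    of_real (\<Psi> x powr - s) * (\<Psi>delta a b \<Psi> ^^ (n - k)) (\<lambda>x. of_real (\<Psi> x powr s) * h x) x"
proof (cases "k = n")
  case True
  have "\<mu> - real n < 0" using \<mu> by (simp add: n) linarith
  moreover have "\<Psi> x > 0" using pos x by auto
  then have "complex_of_real (\<Psi> x powr - s) * (of_real (\<Psi> x powr s) * h x) = h x"
    by (simp add: powr_minus)
  ultimately show ?thesis using True h[OF x] by (simp add: hadamard_RL_def)
next
  case False
  then have kn: "k < n" using k by simp
  then have ge: "\<mu> - real k \<ge> 0" using \<mu> by (simp add: n) linarith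
  have fl: "nat \<lfloor>\<mu> - real k\<rfloor> + 1 = n - k"
    using kn ge \<mu> by (simp add: n) linarith
  have "real (n - k) - (\<mu> - real k) = real n - \<mu>" using kn by simp
  then have "hadamard_RL a b \<Psi> s (\<mu> - real k) f x = hadamard_D a b \<Psi> s (n - k) (hadamard_I a b \<Psi> s (real n - \<mu>) f) x"
    using ge fl by (simp add: hadamard_RL_def Let_def)
  also have "\<dots> = of_real (\<Psi> x powr - s) * (\<Psi>delta a b \<Psi> ^^ (n - k)) (\<lambda>x. of_real (\<Psi> x powr s) * h x) x"
    unfolding hadamard_D_def using h by (subst \<Psi>delta_pow_cong[OF _ x]) auto
  finally show ?thesis .
qed

text \<open>
  The limits \<open>L k\<close> are \<open>\<Psi> a powr - s\<close> times the values at \<open>a\<close> of the continuous functions \<open>\<delta>\<^sup>n\<^sup>-\<^sup>k (\<Psi>\<^sup>s h)\<close>. What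
  remains is to divide the inversion formula for \<open>frac_int\<close> by \<open>w \<Psi>\<^sup>s\<close> and to reindex by \<open>k = n - j\<close>.
\<close>

theorem hadamard_inversion:
  assumes \<mu>: "\<mu> > 0" and n: "n = nat \<lfloor>\<mu>\<rfloor> + 1"
    and f: "set_integrable lebesgue {a..b} f"
    and h: "h \<in> AC_delta a b \<Psi> s n" "\<And>x. x \<in> {a<..b} \<Longrightarrow> h x = hadamard_I a b \<Psi> s (real n - \<mu>) f x"
  shows "\<exists>L :: nat \<Rightarrow> complex.
            (\<forall>k\<in>{1..n}. (hadamard_RL a b \<Psi> s (\<mu> - real k) f \<longlongrightarrow> L k) (at_right a)) \<and>
            (AE x in lebesgue. x \<in> {a..b} \<longrightarrow>
               hadamard_I a b \<Psi> s \<mu> (hadamard_RL a b \<Psi> s \<mu> f) x =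
               f x - of_real ((\<Psi> a / \<Psi> x) powr s) *
                 (\<Sum>k=1..n. of_real (rGamma (\<mu> - real k + 1) *
                                ln (\<Psi> x / \<Psi> a) powr (\<mu> - real k)) * L k))"
proof -
  define G where "G = (\<lambda>j. (\<Psi>delta a b \<Psi> ^^ j) (\<lambda>x. of_real (\<Psi> x powr s) * h x))"
  define L where "L = (\<lambda>k. of_real (\<Psi> a powr - s) * G (n - k) a)"
  have n1: "n \<ge> 1" by (simp add: n)
  have G1: "set_integrable lebesgue {a..b} (\<lambda>t. of_real (wt t) * G (Suc j) t)" if "j < n" for j
    unfolding G_def by (rule AC_delta_ftc(1)[OF n1 h(1) that])
  have G2: "G j x = G j a + (LINT t:{a..x}|lebesgue. of_real (wt t) * G (Suc j) t)" if "j < n" "x \<in> {a..b}" for j x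
    unfolding G_def by (rule AC_delta_ftc(2)[OF n1 h(1) that])
  have G3: "continuous_on {a..b} (G j)" if "j < n" for j
    unfolding G_def by (rule AC_delta_ftc(3)[OF n1 h(1) that])
  have RL: "hadamard_RL a b \<Psi> s (\<mu> - real k) f x = of_real (\<Psi> x powr - s) * G (n - k) x"
    if "k \<le> n" "x \<in> {a<..b}" for k x
    unfolding G_def by (rule hadamard_RL_eq[OF \<mu> n that h(2)])
  have lim: "(hadamard_RL a b \<Psi> s (\<mu> - real k) f \<longlongrightarrow> L k) (at_right a)" if "k \<in> {1..n}" for k
  proof -
    have "continuous_on {a..b} (\<lambda>x. of_real (\<Psi> x powr - s) * G (n - k) x)"
      using that pos by (intro continuous_intros G3 \<Psi>_cont) auto
    then have "((\<lambda>x. of_real (\<Psi> x powr - s) * G (n - k) x) \<longlongrightarrow> L k) (at a within {a..b})"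
      unfolding continuous_on_def L_def using less by auto
    then have "((\<lambda>x. of_real (\<Psi> x powr - s) * G (n - k) x) \<longlongrightarrow> L k) (at_right a)"
      using less by (simp add: at_within_Icc_at_right)
    moreover have "\<forall>\<^sub>F x in at_right a. of_real (\<Psi> x powr - s) * G (n - k) x = hadamard_RL a b \<Psi> s (\<mu> - real k) f x"
      using eventually_at_right_real[OF less] RL that by (auto elim!: eventually_mono)
    ultimately show ?thesis by (rule Lim_transform_eventually)
  qed
  let ?\<phi> = "\<lambda>t. of_real (wt t) * (of_real (\<Psi> t powr s) * f t)"
  have \<phi>: "set_integrable lebesgue {a..b} ?\<phi>"
  proof -
    have c: "continuous_on {a..b} (\<lambda>t. complex_of_real (wt t * \<Psi> t powr s))"
      using pos by (intro continuous_intros wt_cont \<Psi>_cont) auto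
    have "set_integrable lebesgue {a..b} (\<lambda>t. complex_of_real (wt t * \<Psi> t powr s) * f t)"
    proof (rule absolutely_integrable_bounded_measurable_product[where h = "(*)" and f = "\<lambda>t. complex_of_real (wt t * \<Psi> t powr s)", OF _ _ _ _ f])
      show "bilinear ((*) :: complex \<Rightarrow> complex \<Rightarrow> complex)" by (rule bilinear_times)
      show "(\<lambda>t. complex_of_real (wt t * \<Psi> t powr s)) \<in> borel_measurable (lebesgue_on {a..b})"
        by (rule continuous_imp_measurable_on_sets_lebesgue[OF c]) simp
      show "bounded ((\<lambda>t. complex_of_real (wt t * \<Psi> t powr s)) ` {a..b})"
        by (intro compact_imp_bounded compact_continuous_image c) simp
    qed simp
    then show ?thesis by (simp add: mult.assoc)
  qed
  have G0: "G 0 x = frac_int (real n - \<mu>) ?\<phi> x" if x: "x \<in> {a<..b}" for x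
  proof -
    have "\<Psi> x > 0" using pos x by auto
    then show ?thesis using h(2)[OF x] hadamard_I_eq_frac_int[of x s "real n - \<mu>" f] x
      by (simp add: G_def powr_minus)
  qed
  have n\<mu>: "real n - \<mu> > 0" "real n - \<mu> \<le> 1" using \<mu> unfolding n by linarith+
  have inv: "AE x in lebesgue. x \<in> {a..b} \<longrightarrow> ?\<phi> x = of_real (wt x) *
      ((\<Sum>j<n. of_real (rGamma (\<mu> - real n + real j + 1) * (ln (\<Psi> x) - ln (\<Psi> a)) powr (\<mu> - real n + real j)) * G j a)
           + frac_int \<mu> (\<lambda>t. of_real (wt t) * G n t) x)"
    by (rule frac_int_inversion[OF \<mu> n\<mu> \<phi> G1 G2 G0])
  have "AE x in lebesgue. x \<in> {a..b} \<longrightarrow>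
               hadamard_I a b \<Psi> s \<mu> (hadamard_RL a b \<Psi> s \<mu> f) x =
               f x - of_real ((\<Psi> a / \<Psi> x) powr s) *
                 (\<Sum>k=1..n. of_real (rGamma (\<mu> - real k + 1) *
                                ln (\<Psi> x / \<Psi> a) powr (\<mu> - real k)) * L k)"
    using inv
  proof eventually_elim
    case (elim x)
    show ?case
    proof
      assume x: "x \<in> {a..b}"
      have p: "\<Psi> x > 0" "\<Psi> a > 0" using pos x less by auto
      let ?F = "frac_int \<mu> (\<lambda>t. of_real (wt t) * G n t) x"
      let ?S = "\<Sum>k=1..n. of_real (rGamma (\<mu> - real k + 1) * ln (\<Psi> x / \<Psi> a) powr (\<mu> - real k)) * G (n - k) a"
      have "wt x \<noteq> 0" using w_pos[OF x] by simp
      then have "of_real (\<Psi> x powr s) * f x =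
        (\<Sum>j<n. of_real (rGamma (\<mu> - real n + real j + 1) * (ln (\<Psi> x) - ln (\<Psi> a)) powr (\<mu> - real n + real j)) * G j a) + ?F"
        using elim x by simp
      also have "(\<Sum>j<n. of_real (rGamma (\<mu> - real n + real j + 1) * (ln (\<Psi> x) - ln (\<Psi> a)) powr (\<mu> - real n + real j)) * G j a) = ?S"
        by (rule sum.reindex_bij_witness[of _ "\<lambda>k. n - k" "\<lambda>j. n - j"]) (use p in \<open>auto simp: ln_div of_nat_diff algebra_simps\<close>)
      finally have fx: "of_real (\<Psi> x powr s) * f x = ?S + ?F" .
      have "frac_int \<mu> (\<lambda>t. of_real (wt t) * (of_real (\<Psi> t powr s) * hadamard_RL a b \<Psi> s \<mu> f t)) x = ?F"
      proof (rule frac_int_cong_AE, rule AE_Ioc[OF x])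
        fix t assume t: "t \<in> {a<..b}"
        then have "\<Psi> t > 0" using pos by auto
        then show "of_real (wt t) * (of_real (\<Psi> t powr s) * hadamard_RL a b \<Psi> s \<mu> f t) = of_real (wt t) * G n t"
          using RL[of 0 t] t by (simp add: powr_minus)
      qed
      then have "hadamard_I a b \<Psi> s \<mu> (hadamard_RL a b \<Psi> s \<mu> f) x = of_real (\<Psi> x powr - s) * ?F"
        by (simp add: hadamard_I_eq_frac_int[OF x])
      also have "\<dots> = of_real (\<Psi> x powr - s) * (of_real (\<Psi> x powr s) * f x) - of_real (\<Psi> x powr - s) * ?S"
        unfolding fx by (simp add: algebra_simps)
      also have "of_real (\<Psi> x powr - s) * (of_real (\<Psi> x powr s) * f x) = f x"
        using p by (simp add: powr_minus)
      also have "of_real (\<Psi> x powr - s) * ?S = of_real ((\<Psi> a / \<Psi> x) powr s) *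
                 (\<Sum>k=1..n. of_real (rGamma (\<mu> - real k + 1) * ln (\<Psi> x / \<Psi> a) powr (\<mu> - real k)) * L k)"
      proof -
        have "\<Psi> x powr - s = (\<Psi> a / \<Psi> x) powr s * \<Psi> a powr - s"
          using p by (simp add: powr_divide powr_minus field_simps)
        then show ?thesis by (simp add: L_def sum_distrib_left mult_ac)
      qed
      finally show "hadamard_I a b \<Psi> s \<mu> (hadamard_RL a b \<Psi> s \<mu> f) x =
               f x - of_real ((\<Psi> a / \<Psi> x) powr s) *
                 (\<Sum>k=1..n. of_real (rGamma (\<mu> - real k + 1) *
                                ln (\<Psi> x / \<Psi> a) powr (\<mu> - real k)) * L k)" .
    qed
  qed
  with lim show ?thesis by blast
qed

end

text \<open>
  For \<open>\<mu> < 1\<close> the sum has the single term \<open>k = 1\<close>, and the derivative of order \<open>\<mu> - 1\<close> is the integral of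
  order \<open>1 - \<mu>\<close>.
\<close>

theorem theorem3p15:
  fixes a b \<mu> s :: real and n :: nat and \<Psi> :: "real \<Rightarrow> real" and f :: "real \<Rightarrow> complex"
  assumes "a < b"
    and "\<mu> > 0"
    and "n = nat \<lfloor>\<mu>\<rfloor> + 1"
    and "C1_on a b \<Psi>"
    and "mono_on {a..b} \<Psi>"
    and "\<forall>x\<in>{a..b}. \<Psi> x > 0"
    and "\<forall>x\<in>{a..b}. deriv_on a b \<Psi> x \<noteq> 0"
    and "set_integrable lebesgue {a..b} f"
    and "\<exists>h\<in>AC_delta a b \<Psi> s n. \<forall>x\<in>{a<..b}. h x = hadamard_I a b \<Psi> s (real n - \<mu>) f x"
  shows "(\<exists>L :: nat \<Rightarrow> complex.
            (\<forall>k\<in>{1..n}. (hadamard_RL a b \<Psi> s (\<mu> - real k) f \<longlongrightarrow> L k) (at_right a)) \<and>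
            (AE x in lebesgue. x \<in> {a..b} \<longrightarrow>
               hadamard_I a b \<Psi> s \<mu> (hadamard_RL a b \<Psi> s \<mu> f) x =
               f x - of_real ((\<Psi> a / \<Psi> x) powr s) *
                 (\<Sum>k=1..n. of_real (rGamma (\<mu> - real k + 1) *
                                ln (\<Psi> x / \<Psi> a) powr (\<mu> - real k)) * L k)))
       \<and> (\<mu> < 1 \<longrightarrow>
          (\<exists>l :: complex.
            (hadamard_I a b \<Psi> s (1 - \<mu>) f \<longlongrightarrow> l) (at_right a) \<and>
            (AE x in lebesgue. x \<in> {a..b} \<longrightarrow>
               hadamard_I a b \<Psi> s \<mu> (hadamard_RL a b \<Psi> s \<mu> f) x =
               f x - of_real (1 / Gamma \<mu> * (\<Psi> a / \<Psi> x) powr s *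
                              ln (\<Psi> x / \<Psi> a) powr (\<mu> - 1)) * l)))"
proof -
  interpret hadamard_scale a b \<Psi> using assms by unfold_locales
  obtain h where h: "h \<in> AC_delta a b \<Psi> s n" "\<And>x. x \<in> {a<..b} \<Longrightarrow> h x = hadamard_I a b \<Psi> s (real n - \<mu>) f x"
    using assms(9) by blast
  note main = hadamard_inversion[OF assms(2,3,8) h]
  moreover have "\<exists>l :: complex.
            (hadamard_I a b \<Psi> s (1 - \<mu>) f \<longlongrightarrow> l) (at_right a) \<and>
            (AE x in lebesgue. x \<in> {a..b} \<longrightarrow>
               hadamard_I a b \<Psi> s \<mu> (hadamard_RL a b \<Psi> s \<mu> f) x =
               f x - of_real (1 / Gamma \<mu> * (\<Psi> a / \<Psi> x) powr s *
                              ln (\<Psi> x / \<Psi> a) powr (\<mu> - 1)) * l)" if "\<mu> < 1"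
  proof -
    have n1: "n = 1" using that assms(2,3) by (simp add: floor_eq_iff)
    obtain L where L: "\<forall>k\<in>{1..n}. (hadamard_RL a b \<Psi> s (\<mu> - real k) f \<longlongrightarrow> L k) (at_right a)"
      "AE x in lebesgue. x \<in> {a..b} \<longrightarrow>
               hadamard_I a b \<Psi> s \<mu> (hadamard_RL a b \<Psi> s \<mu> f) x =
               f x - of_real ((\<Psi> a / \<Psi> x) powr s) *
                 (\<Sum>k=1..n. of_real (rGamma (\<mu> - real k + 1) *
                                ln (\<Psi> x / \<Psi> a) powr (\<mu> - real k)) * L k)"
      using main by blast
    have "hadamard_RL a b \<Psi> s (\<mu> - real 1) f = hadamard_I a b \<Psi> s (1 - \<mu>) f"
      using that by (simp add: hadamard_RL_def)
    then have "(hadamard_I a b \<Psi> s (1 - \<mu>) f \<longlongrightarrow> L 1) (at_right a)" using L(1) n1 by auto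
    moreover have "of_real ((\<Psi> a / \<Psi> x) powr s) *
                 (\<Sum>k=1..n. of_real (rGamma (\<mu> - real k + 1) * ln (\<Psi> x / \<Psi> a) powr (\<mu> - real k)) * L k)
       = of_real (1 / Gamma \<mu> * (\<Psi> a / \<Psi> x) powr s * ln (\<Psi> x / \<Psi> a) powr (\<mu> - 1)) * L 1" for x
      by (simp add: n1 rGamma_inverse_Gamma inverse_eq_divide)
    ultimately show ?thesis using L(2) by (intro exI[of _ "L 1"] conjI) simp_all
  qed
  ultimately show ?thesis by blast
qed

end
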